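(* Let $(M,\varphi,\xi,\eta,g,\varepsilon,a,c)$ be an $n$-dimensional $\eta$-Einstein $(\varepsilon)$-almost paracontact metric manifold admitting an $\eta$-Ricci soliton $(g,\xi,\lambda,\mu)$ whose potential vector field $\xi$ is torse-forming, $\nabla_X\xi=fX+w(X)\xi$ for all vector fields $X$. Then $f$ is a constant function and $$c=-\varepsilon a+(a+\lambda)^2(1-n),\qquad \mu=-\varepsilon\left(\lambda+\varepsilon(a+\lambda)^2(1-n)\right).$$
   Context: An $(\varepsilon)$-almost paracontact metric structure $(\varphi,\xi,\eta,g,\varepsilon)$ on an $n$-dimensional manifold $M$ consists of a $(1,1)$-tensor field $\varphi$, a vector field $\xi$, a $1$-form $\eta$, a pseudo-Riemannian metric $g$ and $\varepsilon\in\{1,-1\}$ with $\varphi^2=I-\eta\otimes\xi$, $\eta(\xi)=1$, $\varphi\xi=0$, $\eta\circ\varphi=0$ and $g(\varphi X,\varphi Y)=g(X,Y)-\varepsilon\eta(X)\eta(Y)$ for all vector fields $X,Y$. (Consequently $g(X,\xi)=\varepsilon\eta(X)$ and $g(\varphi X,Y)=g(X,\varphi Y)$.) $\nabla$ is the Levi-Civita connection of $g$ and $S$ the Ricci tensor, with conventions $R(X,Y)Z=\nabla_X\nabla_YZ-\nabla_Y\nabla_XZ-\nabla_{[X,Y]}Z$, $S(Y,Z)=\mathrm{trace}(X\mapsto R(X,Y)Z)$. $(M,\varphi,\xi,\eta,g,\varepsilon,a,c)$ is $\eta$-Einstein if $a,c$ are real constants with $S=a\,g+c\,\eta\otimes\eta$.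 $(g,\xi,\lambda,\mu)$, with $\lambda,\mu$ real constants, is an $\eta$-Ricci soliton if $\frac12\mathcal{L}_\xi g+S+\lambda g+\mu\,\eta\otimes\eta=0$. $\xi$ is torse-forming if $\nabla_X\xi=fX+w(X)\xi$ for all vector fields $X$, for some smooth function $f$ and some $1$-form $w$.
   Formalization: That f is constant is claimed only for n ≥ 2: for n = 1 it fails, e.g. M = ℝ, g = dx², ξ = d/dx, η = dx, φ = 0, ε = 1, a = c = λ = μ = 0, f any smooth function, w = −f dx. The formulas for c and μ are proved for every n. *)

theory Defs
  imports "HOL-Analysis.Analysis" "HOL-Library.Function_Algebras"
begin

text \<open>
  Tangent vectors are derivations, hence functions, and vector fields are functions into those;
  both inherit the pointwise vector space structure.
\<close>

instantiation "fun" :: (type, real_vector) real_vector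
begin

definition scaleR_fun :: "real \<Rightarrow> ('a \<Rightarrow> 'b) \<Rightarrow> 'a \<Rightarrow> 'b"
  where "scaleR_fun r f = (\<lambda>x. r *\<^sub>R f x)"

instance
  by standard (simp_all add: scaleR_fun_def fun_eq_iff scaleR_add_right scaleR_add_left)

end


section \<open>Smooth manifolds\<close>

fun C_k_on :: "nat \<Rightarrow> ('e::euclidean_space \<Rightarrow> 'f::real_normed_vector) \<Rightarrow> 'e set \<Rightarrow> bool" where
  "C_k_on 0 f S = continuous_on S f"
| "C_k_on (Suc k) f S =
     ((\<forall>x\<in>S. f differentiable (at x)) \<and> (\<forall>v. C_k_on k (\<lambda>x. frechet_derivative f (at x) v) S))"

text \<open>Only meaningful for open sets, which is the only way it is used.\<close>

definition smooth_on :: "('e::euclidean_space \<Rightarrow> 'f::real_normed_vector) \<Rightarrow> 'e set \<Rightarrow> bool"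
  where "smooth_on f S \<longleftrightarrow> (\<forall>k. C_k_on k f S)"

text \<open>
  A chart is a pair of its domain and the coordinate map; the values of the coordinate map outside
  the domain are irrelevant.
\<close>

type_synonym ('m, 'e) chart = "'m set \<times> ('m \<Rightarrow> 'e)"

definition is_chart :: "('m::topological_space, 'e::euclidean_space) chart \<Rightarrow> bool" where
  "is_chart ch \<longleftrightarrow> (case ch of (U, \<kappa>) \<Rightarrow>
     open U \<and> open (\<kappa> ` U) \<and> homeomorphism U (\<kappa> ` U) \<kappa> (inv_into U \<kappa>))"

text \<open>
  The manifold is the whole type \<^typ>\<open>'m\<close>. An atlas need not be maximal: everything
  below depends on it only through the smooth structure it generates. The dimension is that of
  the model space \<^typ>\<open>'e\<close>.
\<close>

definition smooth_manifold ::
  "('m::{t2_space, second_countable_topology}, 'e::euclidean_space) chart set \<Rightarrow> bool" where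
  "smooth_manifold A \<longleftrightarrow>
     (\<forall>ch\<in>A. is_chart ch) \<and>
     (\<Union>(U, \<kappa>)\<in>A. U) = UNIV \<and>
     (\<forall>(U, \<kappa>)\<in>A. \<forall>(V, \<psi>)\<in>A. smooth_on (\<psi> \<circ> inv_into U \<kappa>) (\<kappa> ` (U \<inter> V)))"

definition smooth_fun :: "('m, 'e::euclidean_space) chart set \<Rightarrow> ('m \<Rightarrow> real) \<Rightarrow> bool" where
  "smooth_fun A f \<longleftrightarrow> (\<forall>(U, \<kappa>)\<in>A. smooth_on (f \<circ> inv_into U \<kappa>) (\<kappa> ` U))"


section \<open>Tangent vectors and tensor fields\<close>

type_synonym 'm tvec = "('m \<Rightarrow> real) \<Rightarrow> real"
type_synonym 'm vfield = "'m \<Rightarrow> 'm tvec"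

text \<open>
  Derivations at a point on the algebra of smooth functions. HOL functions being total, they are
  normalised to vanish on non-smooth arguments, so that equal derivations are equal functions.
\<close>

definition tangent_space :: "('m, 'e::euclidean_space) chart set \<Rightarrow> 'm \<Rightarrow> 'm tvec set" where
  "tangent_space A p = {v.
     (\<forall>f h. smooth_fun A f \<longrightarrow> smooth_fun A h \<longrightarrow>
        v (\<lambda>q. f q + h q) = v f + v h \<and>
        v (\<lambda>q. f q * h q) = f p * v h + h p * v f) \<and>
     (\<forall>r f. smooth_fun A f \<longrightarrow> v (\<lambda>q. r * f q) = r * v f) \<and>
     (\<forall>f. \<not> smooth_fun A f \<longrightarrow> v f = 0)}"

definition vector_field :: "('m, 'e::euclidean_space) chart set \<Rightarrow> 'm vfield \<Rightarrow> bool" where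
  "vector_field A X \<longleftrightarrow>
     (\<forall>p. X p \<in> tangent_space A p) \<and>
     (\<forall>f. smooth_fun A f \<longrightarrow> smooth_fun A (\<lambda>p. X p f))"

definition fscale :: "('m \<Rightarrow> real) \<Rightarrow> 'm vfield \<Rightarrow> 'm vfield"
  where "fscale f X = (\<lambda>p. f p *\<^sub>R X p)"

definition lie_bracket :: "'m vfield \<Rightarrow> 'm vfield \<Rightarrow> 'm vfield"
  where "lie_bracket X Y = (\<lambda>p f. X p (\<lambda>q. Y q f) - Y p (\<lambda>q. X q f))"

definition linear_map_on :: "'v::real_vector set \<Rightarrow> ('v \<Rightarrow> 'w::real_vector) \<Rightarrow> bool" where
  "linear_map_on V h \<longleftrightarrow>
     (\<forall>u\<in>V. \<forall>v\<in>V. h (u + v) = h u + h v) \<and> (\<forall>r. \<forall>v\<in>V. h (r *\<^sub>R v) = r *\<^sub>R h v)"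

definition one_form ::
  "('m, 'e::euclidean_space) chart set \<Rightarrow> ('m \<Rightarrow> 'm tvec \<Rightarrow> real) \<Rightarrow> bool" where
  "one_form A \<omega> \<longleftrightarrow>
     (\<forall>p. linear_map_on (tangent_space A p) (\<omega> p)) \<and>
     (\<forall>X. vector_field A X \<longrightarrow> smooth_fun A (\<lambda>p. \<omega> p (X p)))"

definition tensor_field_1_1 ::
  "('m, 'e::euclidean_space) chart set \<Rightarrow> ('m \<Rightarrow> 'm tvec \<Rightarrow> 'm tvec) \<Rightarrow> bool" where
  "tensor_field_1_1 A T \<longleftrightarrow>
     (\<forall>p. linear_map_on (tangent_space A p) (T p) \<and>
          T p ` tangent_space A p \<subseteq> tangent_space A p) \<and>
     (\<forall>X. vector_field A X \<longrightarrow> vector_field A (\<lambda>p. T p (X p)))"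

definition tensor_field_0_2 ::
  "('m, 'e::euclidean_space) chart set \<Rightarrow> ('m \<Rightarrow> 'm tvec \<Rightarrow> 'm tvec \<Rightarrow> real) \<Rightarrow> bool" where
  "tensor_field_0_2 A g \<longleftrightarrow>
     (\<forall>p. \<forall>u\<in>tangent_space A p.
        linear_map_on (tangent_space A p) (g p u) \<and>
        linear_map_on (tangent_space A p) (\<lambda>v. g p v u)) \<and>
     (\<forall>X Y. vector_field A X \<longrightarrow> vector_field A Y \<longrightarrow> smooth_fun A (\<lambda>p. g p (X p) (Y p)))"


section \<open>Pseudo-Riemannian metrics, Levi-Civita connection, curvature\<close>

definition metric_index ::
  "('m, 'e::euclidean_space) chart set \<Rightarrow> ('m \<Rightarrow> 'm tvec \<Rightarrow> 'm tvec \<Rightarrow> real) \<Rightarrow> 'm \<Rightarrow> nat" where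
  "metric_index A g p =
     Max {dim W | W. subspace W \<and> W \<subseteq> tangent_space A p \<and> (\<forall>v\<in>W. v \<noteq> 0 \<longrightarrow> g p v v < 0)}"

definition pseudo_riemannian_metric ::
  "('m, 'e::euclidean_space) chart set \<Rightarrow> ('m \<Rightarrow> 'm tvec \<Rightarrow> 'm tvec \<Rightarrow> real) \<Rightarrow> bool" where
  "pseudo_riemannian_metric A g \<longleftrightarrow>
     tensor_field_0_2 A g \<and>
     (\<forall>p. \<forall>u\<in>tangent_space A p. \<forall>v\<in>tangent_space A p. g p u v = g p v u) \<and>
     (\<forall>p. \<forall>u\<in>tangent_space A p. (\<forall>v\<in>tangent_space A p. g p u v = 0) \<longrightarrow> u = 0) \<and>
     metric_index A g constant_on UNIV"

text \<open>
  The defining properties of the Levi-Civita connection determine \<open>nabla X Y\<close> for smooth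
  vector fields \<open>X\<close>, \<open>Y\<close>; its values on other arguments are unconstrained and never used.
\<close>

definition affine_connection ::
  "('m, 'e::euclidean_space) chart set \<Rightarrow> ('m vfield \<Rightarrow> 'm vfield \<Rightarrow> 'm vfield) \<Rightarrow> bool" where
  "affine_connection A nabla \<longleftrightarrow>
     (\<forall>X Y. vector_field A X \<longrightarrow> vector_field A Y \<longrightarrow> vector_field A (nabla X Y)) \<and>
     (\<forall>X Y Z. vector_field A X \<longrightarrow> vector_field A Y \<longrightarrow> vector_field A Z \<longrightarrow>
        nabla (X + Y) Z = nabla X Z + nabla Y Z \<and>
        nabla X (Y + Z) = nabla X Y + nabla X Z) \<and>
     (\<forall>f X Y. smooth_fun A f \<longrightarrow> vector_field A X \<longrightarrow> vector_field A Y \<longrightarrow>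
        nabla (fscale f X) Y = fscale f (nabla X Y) \<and>
        nabla X (fscale f Y) = fscale (\<lambda>p. X p f) Y + fscale f (nabla X Y))"

definition levi_civita ::
  "('m, 'e::euclidean_space) chart set \<Rightarrow> ('m \<Rightarrow> 'm tvec \<Rightarrow> 'm tvec \<Rightarrow> real) \<Rightarrow>
   ('m vfield \<Rightarrow> 'm vfield \<Rightarrow> 'm vfield) \<Rightarrow> bool" where
  "levi_civita A g nabla \<longleftrightarrow>
     affine_connection A nabla \<and>
     (\<forall>X Y. vector_field A X \<longrightarrow> vector_field A Y \<longrightarrow>
        nabla X Y - nabla Y X = lie_bracket X Y) \<and>
     (\<forall>X Y Z p. vector_field A X \<longrightarrow> vector_field A Y \<longrightarrow> vector_field A Z \<longrightarrow>
        X p (\<lambda>q. g q (Y q) (Z q)) = g p (nabla X Y p) (Z p) + g p (Y p) (nabla X Z p))"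

definition curvature ::
  "('m vfield \<Rightarrow> 'm vfield \<Rightarrow> 'm vfield) \<Rightarrow> 'm vfield \<Rightarrow> 'm vfield \<Rightarrow> 'm vfield \<Rightarrow> 'm vfield" where
  "curvature nabla X Y Z =
     nabla X (nabla Y Z) - nabla Y (nabla X Z) - nabla (lie_bracket X Y) Z"

text \<open>Trace of an endomorphism of a finite-dimensional subspace; independent of the basis.\<close>

definition trace_on :: "'v::real_vector set \<Rightarrow> ('v \<Rightarrow> 'v) \<Rightarrow> real" where
  "trace_on V h =
     (let B = (SOME B. independent B \<and> span B = V) in \<Sum>b\<in>B. representation B (h b) b)"

text \<open>
  Since the curvature is tensorial, the endomorphism \<open>x \<mapsto> R(x, Y)Z\<close> of the tangent space at
  \<open>p\<close> may be computed with an arbitrary smooth extension of the tangent vector \<open>x\<close>.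
\<close>

definition extension :: "('m, 'e::euclidean_space) chart set \<Rightarrow> 'm \<Rightarrow> 'm tvec \<Rightarrow> 'm vfield"
  where "extension A p x = (SOME X. vector_field A X \<and> X p = x)"

definition ricci ::
  "('m, 'e::euclidean_space) chart set \<Rightarrow> ('m vfield \<Rightarrow> 'm vfield \<Rightarrow> 'm vfield) \<Rightarrow>
   'm vfield \<Rightarrow> 'm vfield \<Rightarrow> 'm \<Rightarrow> real" where
  "ricci A nabla Y Z p =
     trace_on (tangent_space A p) (\<lambda>x. curvature nabla (extension A p x) Y Z p)"

definition lie_derivative_metric ::
  "'m vfield \<Rightarrow> ('m \<Rightarrow> 'm tvec \<Rightarrow> 'm tvec \<Rightarrow> real) \<Rightarrow> 'm vfield \<Rightarrow> 'm vfield \<Rightarrow> 'm \<Rightarrow> real" where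
  "lie_derivative_metric V g X Y p =
     V p (\<lambda>q. g q (X q) (Y q)) - g p (lie_bracket V X p) (Y p) - g p (X p) (lie_bracket V Y p)"


section \<open>Almost paracontact metric structures and solitons\<close>

definition almost_paracontact_metric ::
  "('m, 'e::euclidean_space) chart set \<Rightarrow> ('m \<Rightarrow> 'm tvec \<Rightarrow> 'm tvec) \<Rightarrow> 'm vfield \<Rightarrow>
   ('m \<Rightarrow> 'm tvec \<Rightarrow> real) \<Rightarrow> ('m \<Rightarrow> 'm tvec \<Rightarrow> 'm tvec \<Rightarrow> real) \<Rightarrow> real \<Rightarrow> bool" where
  "almost_paracontact_metric A \<phi> \<xi> \<eta> g \<epsilon> \<longleftrightarrow>
     tensor_field_1_1 A \<phi> \<and> vector_field A \<xi> \<and> one_form A \<eta> \<and>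
     pseudo_riemannian_metric A g \<and> \<epsilon> \<in> {1, -1} \<and>
     (\<forall>p. \<forall>x\<in>tangent_space A p. \<phi> p (\<phi> p x) = x - \<eta> p x *\<^sub>R \<xi> p) \<and>
     (\<forall>p. \<eta> p (\<xi> p) = 1) \<and>
     (\<forall>p. \<phi> p (\<xi> p) = 0) \<and>
     (\<forall>p. \<forall>x\<in>tangent_space A p. \<eta> p (\<phi> p x) = 0) \<and>
     (\<forall>X Y. vector_field A X \<longrightarrow> vector_field A Y \<longrightarrow>
        (\<forall>p. g p (\<phi> p (X p)) (\<phi> p (Y p)) = g p (X p) (Y p) - \<epsilon> * \<eta> p (X p) * \<eta> p (Y p)))"

definition eta_Einstein ::
  "('m, 'e::euclidean_space) chart set \<Rightarrow> ('m \<Rightarrow> 'm tvec \<Rightarrow> real) \<Rightarrow>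
   ('m \<Rightarrow> 'm tvec \<Rightarrow> 'm tvec \<Rightarrow> real) \<Rightarrow> ('m vfield \<Rightarrow> 'm vfield \<Rightarrow> 'm vfield) \<Rightarrow>
   real \<Rightarrow> real \<Rightarrow> bool" where
  "eta_Einstein A \<eta> g nabla a c \<longleftrightarrow>
     (\<forall>X Y. vector_field A X \<longrightarrow> vector_field A Y \<longrightarrow>
        (\<forall>p. ricci A nabla X Y p = a * g p (X p) (Y p) + c * (\<eta> p (X p) * \<eta> p (Y p))))"

definition eta_Ricci_soliton ::
  "('m, 'e::euclidean_space) chart set \<Rightarrow> ('m \<Rightarrow> 'm tvec \<Rightarrow> real) \<Rightarrow>
   ('m \<Rightarrow> 'm tvec \<Rightarrow> 'm tvec \<Rightarrow> real) \<Rightarrow> ('m vfield \<Rightarrow> 'm vfield \<Rightarrow> 'm vfield) \<Rightarrow>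
   'm vfield \<Rightarrow> real \<Rightarrow> real \<Rightarrow> bool" where
  "eta_Ricci_soliton A \<eta> g nabla \<xi> lam \<mu> \<longleftrightarrow>
     (\<forall>X Y. vector_field A X \<longrightarrow> vector_field A Y \<longrightarrow>
        (\<forall>p. 1 / 2 * lie_derivative_metric \<xi> g X Y p + ricci A nabla X Y p
              + lam * g p (X p) (Y p) + \<mu> * (\<eta> p (X p) * \<eta> p (Y p)) = 0))"

definition torse_forming ::
  "('m, 'e::euclidean_space) chart set \<Rightarrow> ('m vfield \<Rightarrow> 'm vfield \<Rightarrow> 'm vfield) \<Rightarrow>
   'm vfield \<Rightarrow> ('m \<Rightarrow> real) \<Rightarrow> ('m \<Rightarrow> 'm tvec \<Rightarrow> real) \<Rightarrow> bool" where
  "torse_forming A nabla \<xi> f w \<longleftrightarrow>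
     smooth_fun A f \<and> one_form A w \<and>
     (\<forall>X. vector_field A X \<longrightarrow> nabla X \<xi> = fscale f X + fscale (\<lambda>p. w p (X p)) \<xi>)"

end

theory Submission
  imports Defs
begin

text \<open>
  On the geometric side everything follows from \<open>\<nabla>\<^sub>X\<xi> = k (X - \<eta>(X) \<xi>)\<close> with the constant
  \<open>k = -(a + \<lambda>)\<close>. Since \<open>g(\<xi>, \<xi>) = \<epsilon>\<close> is constant, \<open>\<nabla>\<^sub>X\<xi>\<close> is orthogonal to \<open>\<xi>\<close>, which
  forces \<open>w = -f \<eta>\<close> and hence \<open>\<nabla>\<^sub>X\<xi> = f (X - \<eta>(X) \<xi>)\<close> (\<open>torse_forming_nabla\<close>). Then
  \<open>L\<^sub>\<xi> g = 2f (g - \<epsilon> \<eta> \<otimes> \<eta>)\<close>, and the soliton equation together with the Einstein equation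
  becomes \<open>(f + a + \<lambda>) g + (c + \<mu> - \<epsilon> f) \<eta> \<otimes> \<eta> = 0\<close>. Its value on \<open>\<xi>\<close> relates \<open>\<mu>\<close> to \<open>c\<close>, and
  by nondegeneracy of \<open>g\<close> it also gives \<open>(f + a + \<lambda>) (X - \<eta>(X) \<xi>) = 0\<close>
  (\<open>torse_forming_soliton\<close>). In dimension at least two some \<open>X\<close> is not proportional to \<open>\<xi>\<close>, so
  that \<open>f = -(a + \<lambda>)\<close>; in every dimension \<open>f\<close> may be replaced by this constant in the formula
  for \<open>\<nabla>\<^sub>X\<xi>\<close>.

  With a constant factor the curvature is \<open>R(X, Y)\<xi> = k\<^sup>2 (\<eta>(X) Y - \<eta>(Y) X)\<close>
  (\<open>curvature_xi\<close>): the derivatives of \<open>\<eta>\<close> cancel because \<open>\<eta>\<close> is closed. The trace over \<open>X\<close> is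
  \<open>S(Y, \<xi>) = k\<^sup>2 (1 - n) \<eta>(Y)\<close> (\<open>ricci_xi\<close>), and comparison with the Einstein equation at
  \<open>Y = \<xi>\<close> yields \<open>c\<close>.

  Two facts about the space of derivations at a point are used here: its dimension is that of the
  model space (\<open>tangent_space_basis\<close>), as the trace of the identity enters, and every derivation
  is the value of a smooth vector field (\<open>vector_field_through_exists\<close>), as the hypotheses speak
  of vector fields while nondegeneracy is pointwise. Both come from a chart. A bump function turns
  the coordinate derivatives into global vector fields, and Hadamard's lemma
  \<open>h(x) = h(p) + \<Sum>\<^sub>b (x - p)\<^sub>b G\<^sub>b(x)\<close> shows that a derivation is determined by its values on
  the coordinates (\<open>tangent_eq_chart_deriv\<close>). The coefficients \<open>G\<^sub>b\<close> are means of the partial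
  derivatives of \<open>h\<close> along rays, and smooth by differentiation under the integral sign.
\<close>

section \<open>Calculus of finitely often differentiable maps\<close>

lemma C_k_on_has_derivative:
  assumes "C_k_on (Suc k) f S" and "x \<in> S"
  shows "(f has_derivative frechet_derivative f (at x)) (at x)"
  using assms by (simp add: frechet_derivative_works)

lemma C_k_on_cong:
  assumes "open S" and "\<And>x. x \<in> S \<Longrightarrow> f x = g x" and "C_k_on k f S"
  shows "C_k_on k g S"
  using assms(2,3)
proof (induction k arbitrary: f g)
  case 0
  then show ?case by (metis C_k_on.simps(1) continuous_on_cong)
next
  case (Suc k)
  have d: "(g has_derivative frechet_derivative f (at x)) (at x)" if "x \<in> S" for x
    using has_derivative_transform_within_open[OF C_k_on_has_derivative[OF Suc.prems(2) that]
        \<open>open S\<close> that] Suc.prems(1) by simp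
  then have "frechet_derivative f (at x) = frechet_derivative g (at x)" if "x \<in> S" for x
    using that frechet_derivative_at by blast
  then have "C_k_on k (\<lambda>x. frechet_derivative g (at x) v) S" for v
    using Suc.prems(2) Suc.IH[of "\<lambda>x. frechet_derivative f (at x) v"] by simp
  with d show ?case by (auto simp: differentiable_def)
qed

text \<open>
  Any pointwise given derivative may serve in place of \<^const>\<open>frechet_derivative\<close>, which
  is the step in the inductions for sums, products and composites.
\<close>

lemma C_k_on_SucI:
  assumes "open S" and "\<And>x. x \<in> S \<Longrightarrow> (f has_derivative f' x) (at x)"
    and "\<And>v. C_k_on k (\<lambda>x. f' x v) S"
  shows "C_k_on (Suc k) f S"
proof -
  have "f' x = frechet_derivative f (at x)" if "x \<in> S" for x
    using assms(2)[OF that] by (rule frechet_derivative_at)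
  then have "C_k_on k (\<lambda>x. frechet_derivative f (at x) v) S" for v
    using C_k_on_cong[OF \<open>open S\<close> _ assms(3)[of v]] by simp
  with assms(2) show ?thesis by (auto simp: differentiable_def)
qed

lemma C_k_on_lower: "C_k_on (Suc k) f S \<Longrightarrow> C_k_on k f S"
proof (induction k arbitrary: f)
  case 0
  then show ?case
    by (auto intro!: continuous_at_imp_continuous_on differentiable_imp_continuous_within)
qed auto

lemma C_k_on_subset: "C_k_on k f S \<Longrightarrow> T \<subseteq> S \<Longrightarrow> C_k_on k f T"
  by (induction k arbitrary: f) (auto intro: continuous_on_subset)

lemma C_k_on_Un:
  assumes "open S" "open T" "C_k_on k f S" "C_k_on k f T"
  shows "C_k_on k f (S \<union> T)"
  using assms(3,4) by (induction k arbitrary: f) (auto intro: continuous_on_open_Un assms(1,2))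

lemma C_k_on_const: "open S \<Longrightarrow> C_k_on k (\<lambda>x. c) S"
proof (induction k arbitrary: c)
  case (Suc k)
  show ?case
    by (rule C_k_on_SucI[where f' = "\<lambda>x v. 0"]) (auto intro: Suc)
qed simp

lemma C_k_on_bounded_linear:
  assumes "bounded_linear L" "open S"
  shows "C_k_on k L S"
proof (cases k)
  case 0
  then show ?thesis by (simp add: assms linear_continuous_on)
next
  case (Suc j)
  show ?thesis unfolding Suc
    by (rule C_k_on_SucI[where f' = "\<lambda>x. L"])
      (auto intro: assms bounded_linear_imp_has_derivative C_k_on_const)
qed

lemma C_k_on_add:
  assumes "open S" "C_k_on k f S" "C_k_on k g S"
  shows "C_k_on k (\<lambda>x. f x + g x) S"
  using assms(2,3)
proof (induction k arbitrary: f g)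
  case (Suc k)
  show ?case
    by (rule C_k_on_SucI[OF \<open>open S\<close> has_derivative_add[OF
            C_k_on_has_derivative[OF Suc.prems(1)] C_k_on_has_derivative[OF Suc.prems(2)]]])
      (use Suc in auto)
qed (auto intro: continuous_intros)

lemma C_k_on_sum:
  assumes "open S" "\<And>i. i \<in> I \<Longrightarrow> C_k_on k (f i) S"
  shows "C_k_on k (\<lambda>x. \<Sum>i\<in>I. f i x) S"
  using assms(2)
  by (induction I rule: infinite_finite_induct) (auto intro: C_k_on_const C_k_on_add \<open>open S\<close>)

lemma C_k_on_bilinear:
  assumes "bounded_bilinear B" "open S" "C_k_on k f S" "C_k_on k g S"
  shows "C_k_on k (\<lambda>x. B (f x) (g x)) S"
  using assms(3,4)
proof (induction k arbitrary: f g)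
  case 0
  then show ?case by (auto intro: bounded_bilinear.continuous_on[OF assms(1)])
next
  case (Suc k)
  note low = Suc.prems[THEN C_k_on_lower]
  show ?case
    by (rule C_k_on_SucI[OF \<open>open S\<close> bounded_bilinear.FDERIV[OF assms(1)
            C_k_on_has_derivative[OF Suc.prems(1)] C_k_on_has_derivative[OF Suc.prems(2)]]])
      (use Suc low in \<open>auto intro!: C_k_on_add \<open>open S\<close>\<close>)
qed

text \<open>
  The chain rule is the induction step, once the inner derivative is expanded in the standard
  basis: the outer factors are then again composites, of partial derivatives of \<open>g\<close> with \<open>f\<close>.
\<close>

lemma C_k_on_compose:
  fixes f :: "'a::euclidean_space \<Rightarrow> 'b::euclidean_space"
  assumes "open S" "open T" "f ` S \<subseteq> T" "C_k_on k f S" "C_k_on k g T"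
  shows "C_k_on k (\<lambda>x. g (f x)) S"
  using assms(4,5)
proof (induction k arbitrary: g)
  case 0
  then show ?case using continuous_on_compose2 assms(3) by (metis C_k_on.simps(1))
next
  case (Suc k)
  let ?D = "\<lambda>x v. \<Sum>b\<in>Basis. (frechet_derivative f (at x) v \<bullet> b) *\<^sub>R frechet_derivative g (at (f x)) b"
  show ?case
  proof (rule C_k_on_SucI[OF \<open>open S\<close>, where f' = ?D])
    fix x assume "x \<in> S"
    have df: "(f has_derivative frechet_derivative f (at x)) (at x)"
      by (rule C_k_on_has_derivative[OF Suc.prems(1) \<open>x \<in> S\<close>])
    have dg: "(g has_derivative frechet_derivative g (at (f x))) (at (f x))"
      by (rule C_k_on_has_derivative[OF Suc.prems(2)]) (use \<open>x \<in> S\<close> assms(3) in auto)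
    have lin: "linear (frechet_derivative g (at (f x)))"
      using dg has_derivative_linear by blast
    have "frechet_derivative g (at (f x)) (frechet_derivative f (at x) v) = ?D x v" for v
      by (subst euclidean_representation[symmetric, of "frechet_derivative f (at x) v"])
        (simp add: linear_sum[OF lin] linear_cmul[OF lin])
    then show "((\<lambda>x. g (f x)) has_derivative ?D x) (at x)"
      using has_derivative_compose[OF df dg] by simp
  next
    fix v
    have 1: "C_k_on k (\<lambda>x. frechet_derivative f (at x) v \<bullet> b) S" for b
      by (rule C_k_on_bilinear[OF bounded_bilinear_inner \<open>open S\<close> _ C_k_on_const[OF \<open>open S\<close>]])
        (use Suc.prems in simp)
    have 2: "C_k_on k (\<lambda>x. frechet_derivative g (at (f x)) b) S" for b
      by (rule Suc.IH[OF C_k_on_lower[OF Suc.prems(1)]]) (use Suc.prems in simp)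
    show "C_k_on k (\<lambda>x. ?D x v) S"
      by (intro C_k_on_sum C_k_on_bilinear[OF bounded_bilinear_scaleR] 1 2 \<open>open S\<close>)
  qed
qed

lemma smooth_on_cong:
  "open S \<Longrightarrow> (\<And>x. x \<in> S \<Longrightarrow> f x = g x) \<Longrightarrow> smooth_on f S \<Longrightarrow> smooth_on g S"
  unfolding smooth_on_def by (blast intro: C_k_on_cong)

lemma smooth_on_subset: "smooth_on f S \<Longrightarrow> T \<subseteq> S \<Longrightarrow> smooth_on f T"
  unfolding smooth_on_def by (blast intro: C_k_on_subset)

lemma smooth_on_Un:
  "open S \<Longrightarrow> open T \<Longrightarrow> smooth_on f S \<Longrightarrow> smooth_on f T \<Longrightarrow> smooth_on f (S \<union> T)"
  unfolding smooth_on_def by (blast intro: C_k_on_Un)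

lemma smooth_on_const: "open S \<Longrightarrow> smooth_on (\<lambda>x. c) S"
  unfolding smooth_on_def by (blast intro: C_k_on_const)

lemma smooth_on_ident: "open S \<Longrightarrow> smooth_on (\<lambda>x. x) S"
  unfolding smooth_on_def by (blast intro: C_k_on_bounded_linear bounded_linear_ident)

lemma smooth_on_add:
  "open S \<Longrightarrow> smooth_on f S \<Longrightarrow> smooth_on g S \<Longrightarrow> smooth_on (\<lambda>x. f x + g x) S"
  unfolding smooth_on_def by (blast intro: C_k_on_add)

lemma smooth_on_mult:
  fixes f g :: "_ \<Rightarrow> real"
  shows "open S \<Longrightarrow> smooth_on f S \<Longrightarrow> smooth_on g S \<Longrightarrow> smooth_on (\<lambda>x. f x * g x) S"
  unfolding smooth_on_def by (blast intro: C_k_on_bilinear bounded_bilinear_mult)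

lemma smooth_on_inner:
  "open S \<Longrightarrow> smooth_on f S \<Longrightarrow> smooth_on g S \<Longrightarrow> smooth_on (\<lambda>x. f x \<bullet> g x) S"
  unfolding smooth_on_def by (blast intro: C_k_on_bilinear bounded_bilinear_inner)

lemma smooth_on_diff:
  assumes "open S" "smooth_on f S" "smooth_on g S"
  shows "smooth_on (\<lambda>x. f x - g x) S"
proof -
  have "C_k_on k (\<lambda>x. f x + (-1) *\<^sub>R g x) S" for k
    using assms by (intro C_k_on_add C_k_on_bilinear[OF bounded_bilinear_scaleR] C_k_on_const)
      (auto simp: smooth_on_def)
  then show ?thesis by (simp add: smooth_on_def)
qed

lemma smooth_on_compose:
  fixes f :: "'a::euclidean_space \<Rightarrow> 'b::euclidean_space"
  shows "open S \<Longrightarrow> open T \<Longrightarrow> f ` S \<subseteq> T \<Longrightarrow> smooth_on f S \<Longrightarrow> smooth_on g T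
    \<Longrightarrow> smooth_on (\<lambda>x. g (f x)) S"
  unfolding smooth_on_def by (blast intro: C_k_on_compose)

lemma smooth_on_frechet_derivative:
  "smooth_on f S \<Longrightarrow> smooth_on (\<lambda>x. frechet_derivative f (at x) v) S"
  unfolding smooth_on_def by (metis C_k_on.simps(2))

lemma smooth_on_has_derivative:
  "smooth_on f S \<Longrightarrow> x \<in> S \<Longrightarrow> (f has_derivative frechet_derivative f (at x)) (at x)"
  unfolding smooth_on_def by (blast intro: C_k_on_has_derivative)

lemma smooth_on_continuous_on: "smooth_on f S \<Longrightarrow> continuous_on S f"
  unfolding smooth_on_def by (metis C_k_on.simps(1))


section \<open>Bump functions\<close>

text \<open>
  With polynomials \<open>P\<close> as parameters this family of functions is closed under
  differentiation, so that one induction shows that all of its members are smooth.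
\<close>

definition flat_fun :: "real poly \<Rightarrow> real \<Rightarrow> real" where
  "flat_fun P t = (if t > 0 then poly P (1 / t) * exp (- (1 / t)) else 0)"

lemma flat_fun_tendsto_0: "(flat_fun P \<longlongrightarrow> 0) (at 0)"
proof (rule filterlim_split_at)
  have "((\<lambda>x. \<Sum>i\<le>degree P. coeff P i * (x ^ i / exp x)) \<longlongrightarrow> (\<Sum>i\<le>degree P. coeff P i * 0)) at_top"
    by (intro tendsto_intros tendsto_power_div_exp_0)
  then have "((\<lambda>x. poly P x * exp (- x)) \<longlongrightarrow> 0) at_top"
    by (simp add: poly_altdef sum_distrib_right sum_divide_distrib exp_minus field_simps)
  from filterlim_compose[OF this filterlim_inverse_at_top_right]
  have "((\<lambda>t. poly P (1 / t) * exp (- (1 / t))) \<longlongrightarrow> 0) (at_right 0)"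
    by (simp add: inverse_eq_divide)
  then show "(flat_fun P \<longlongrightarrow> 0) (at_right 0)"
    by (rule Lim_transform_eventually)
      (auto simp: flat_fun_def eventually_at_filter)
  show "(flat_fun P \<longlongrightarrow> 0) (at_left 0)"
    by (rule Lim_transform_eventually[OF tendsto_const])
      (auto simp: flat_fun_def eventually_at_filter)
qed

lemma flat_fun_DERIV:
  "(flat_fun P has_real_derivative flat_fun ([:0, 0, 1:] * (P - pderiv P)) t) (at t)"
proof -
  consider "t > 0" | "t < 0" | "t = 0" by linarith
  then show ?thesis
  proof cases
    case 1
    have "((\<lambda>t. poly P (1 / t) * exp (- (1 / t))) has_real_derivative
        flat_fun ([:0, 0, 1:] * (P - pderiv P)) t) (at t)"
      using 1 by (auto intro!: derivative_eq_intros DERIV_chain2[OF poly_DERIV]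
          simp: flat_fun_def field_simps power2_eq_square)
    then show ?thesis
      by (rule has_field_derivative_transform_within_open[where S = "{0<..}"])
        (use 1 in \<open>auto simp: flat_fun_def\<close>)
  next
    case 2
    have "((\<lambda>t. 0) has_real_derivative flat_fun ([:0, 0, 1:] * (P - pderiv P)) t) (at t)"
      using 2 by (simp add: flat_fun_def)
    then show ?thesis
      by (rule has_field_derivative_transform_within_open[where S = "{..<0}"])
        (use 2 in \<open>auto simp: flat_fun_def\<close>)
  next
    case 3
    have "((\<lambda>h. (flat_fun P (0 + h) - flat_fun P 0) / h) \<longlongrightarrow> 0) (at 0)"
      \<comment> \<open>the difference quotient at the origin is again in the family\<close>
      by (rule Lim_transform_eventually[OF flat_fun_tendsto_0[of "pCons 0 P"]])
        (auto simp: flat_fun_def eventually_at_filter)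
    then show ?thesis by (simp add: 3 DERIV_def) (simp add: flat_fun_def)
  qed
qed

lemma smooth_on_flat_fun: "smooth_on (flat_fun P) UNIV"
proof -
  have "C_k_on k (flat_fun P) UNIV" for k
  proof (induction k arbitrary: P)
    case 0
    then show ?case
      by (auto intro!: continuous_at_imp_continuous_on DERIV_isCont flat_fun_DERIV)
  next
    case (Suc k)
    show ?case
      by (rule C_k_on_SucI[OF open_UNIV flat_fun_DERIV[unfolded has_field_derivative_def]])
        (intro C_k_on_bilinear[OF bounded_bilinear_mult] C_k_on_const Suc open_UNIV)
  qed
  then show ?thesis by (simp add: smooth_on_def)
qed

lemma smooth_bump_exists:
  fixes p :: "'e::euclidean_space"
  assumes "r > 0"
  obtains \<beta> :: "'e \<Rightarrow> real" where "smooth_on \<beta> UNIV" "\<beta> p = 1" "\<And>x. x \<notin> cball p r \<Longrightarrow> \<beta> x = 0"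
proof
  let ?\<beta> = "\<lambda>x. flat_fun 1 (r\<^sup>2 - (x - p) \<bullet> (x - p)) * (1 / flat_fun 1 (r\<^sup>2))"
  show "smooth_on ?\<beta> UNIV"
    by (intro smooth_on_mult smooth_on_const smooth_on_diff smooth_on_inner smooth_on_ident
        smooth_on_compose[OF _ _ _ _ smooth_on_flat_fun]) auto
  show "?\<beta> p = 1" using assms by (simp add: flat_fun_def)
  show "?\<beta> x = 0" if "x \<notin> cball p r" for x
  proof -
    have "r\<^sup>2 \<le> (norm (x - p))\<^sup>2"
      using that assms by (intro power_mono) (auto simp: dist_norm norm_minus_commute)
    then show ?thesis by (simp add: flat_fun_def power2_norm_eq_inner)
  qed
qed


section \<open>Taylor expansion of first order with smooth coefficients\<close>

text \<open>
  The moments \<open>\<integral> t\<^sup>m h (p + t (x - p)) dt\<close> of a smooth function along the rays from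
  \<open>p\<close>. Differentiation under the integral sign turns the moment of order \<open>m\<close> of \<open>h\<close> into the
  moment of order \<open>m + 1\<close> of a partial derivative of \<open>h\<close>, which again makes smoothness an
  induction.
\<close>

definition ray_moment :: "'e::euclidean_space \<Rightarrow> nat \<Rightarrow> ('e \<Rightarrow> real) \<Rightarrow> 'e \<Rightarrow> real" where
  "ray_moment p m h x = integral {0..1} (\<lambda>t. t ^ m * h (p + t *\<^sub>R (x - p)))"

lemma ray_in_ball:
  fixes p :: "'e::euclidean_space"
  assumes "x \<in> ball p r" "0 \<le> t" "t \<le> 1"
  shows "p + t *\<^sub>R (x - p) \<in> ball p r"
  using convexD_alt[OF convex_ball, of p p r x t] assms
  by (auto simp: algebra_simps intro: le_less_trans[OF zero_le_dist])

lemma continuous_on_along_ray: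
  fixes h :: "'e::euclidean_space \<Rightarrow> real"
  assumes "continuous_on (ball p r) h"
  shows "continuous_on (ball p r \<times> {0..1}) (\<lambda>(x, t). t ^ m * h (p + t *\<^sub>R (x - p)))"
  unfolding split_beta
  by (intro continuous_intros continuous_on_compose2[OF assms]) (auto intro: ray_in_ball simp del: mem_ball)

lemma integrable_along_ray:
  fixes h :: "'e::euclidean_space \<Rightarrow> real"
  assumes "continuous_on (ball p r) h" and "x \<in> ball p r"
  shows "(\<lambda>t. t ^ m * h (p + t *\<^sub>R (x - p))) integrable_on {0..1}"
  by (intro integrable_continuous_real continuous_intros continuous_on_compose2[OF assms(1)])
    (auto intro: ray_in_ball assms(2) simp del: mem_ball)

lemma ray_moment_has_derivative:
  fixes h :: "'e::euclidean_space \<Rightarrow> real"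
  assumes "smooth_on h (ball p r)" and x0: "x0 \<in> ball p r"
  shows "(ray_moment p m h has_derivative
           (\<lambda>v. ray_moment p (Suc m) (\<lambda>y. frechet_derivative h (at y) v) x0)) (at x0)"
proof -
  define D where "D y = frechet_derivative h (at y)" for y
  have bl: "bounded_linear (D y)" if "y \<in> ball p r" for y
    using smooth_on_has_derivative[OF assms(1) that] has_derivative_bounded_linear
    unfolding D_def by blast
  let ?f = "\<lambda>x t. t ^ m * h (p + t *\<^sub>R (x - p))"
  let ?fx = "\<lambda>x t. t ^ Suc m *\<^sub>R Blinfun (D (p + t *\<^sub>R (x - p)))"
  have apply_fx: "blinfun_apply (?fx x t) v = t ^ Suc m * D (p + t *\<^sub>R (x - p)) v"
    if "x \<in> ball p r" "t \<in> {0..1}" for x t v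
    using that ray_in_ball[of x p r t] by (simp add: scaleR_blinfun.rep_eq bounded_linear_Blinfun_apply bl)
  have cont: "continuous_on (ball p r \<times> {0..1}) (\<lambda>(x, t). ?fx x t)"
  proof (rule continuous_on_blinfun_componentwise)
    fix v :: 'e
    have "continuous_on (ball p r \<times> {0..1}) (\<lambda>(x, t). t ^ Suc m * D (p + t *\<^sub>R (x - p)) v)"
      unfolding D_def
      by (rule continuous_on_along_ray)
        (rule smooth_on_continuous_on[OF smooth_on_frechet_derivative[OF assms(1)]])
    then show "continuous_on (ball p r \<times> {0..1}) (\<lambda>z. blinfun_apply (case z of (x, t) \<Rightarrow> ?fx x t) v)"
      by (rule continuous_on_eq) (auto simp del: mem_ball power_Suc simp: apply_fx)
  qed
  have int: "?fx x0 integrable_on {0..1}"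
  proof (rule integrable_continuous_real)
    have "continuous_on {0..1} (\<lambda>t. (x0, t))"
      by (intro continuous_intros)
    from continuous_on_compose2[OF cont this] x0 show "continuous_on {0..1} (?fx x0)"
      by (auto simp del: mem_ball)
  qed
  have "((\<lambda>x. integral (cbox 0 1) (?f x)) has_derivative integral (cbox 0 1) (?fx x0))
      (at x0 within ball p r)"
  proof (rule leibniz_rule[where U = "ball p r"])
    fix x and t :: real assume xt: "x \<in> ball p r" "t \<in> cbox 0 1"
    then have y: "p + t *\<^sub>R (x - p) \<in> ball p r" by (intro ray_in_ball) auto
    have ray: "((\<lambda>x. p + t *\<^sub>R (x - p)) has_derivative (\<lambda>v. t *\<^sub>R v)) (at x)"
      by (auto intro!: derivative_eq_intros)
    have "((\<lambda>x. ?f x t) has_derivative (\<lambda>v. t ^ m * D (p + t *\<^sub>R (x - p)) (t *\<^sub>R v))) (at x)"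
      unfolding D_def
      by (rule has_derivative_mult_right)
        (rule has_derivative_compose[OF ray smooth_on_has_derivative[OF assms(1) y]])
    moreover have "(\<lambda>v. t ^ m * D (p + t *\<^sub>R (x - p)) (t *\<^sub>R v)) = blinfun_apply (?fx x t)"
    proof
      fix v
      have "blinfun_apply (?fx x t) v = t ^ Suc m * D (p + t *\<^sub>R (x - p)) v"
        using xt by (intro apply_fx) auto
      then show "t ^ m * D (p + t *\<^sub>R (x - p)) (t *\<^sub>R v) = blinfun_apply (?fx x t) v"
        by (simp add: linear_cmul[OF bounded_linear.linear[OF bl[OF y]]])
    qed
    ultimately show "((\<lambda>x. ?f x t) has_derivative blinfun_apply (?fx x t)) (at x within ball p r)"
      by (simp add: has_derivative_at_withinI)
  next
    fix x assume "x \<in> ball p r"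
    then show "?f x integrable_on cbox 0 1"
      using integrable_along_ray[OF smooth_on_continuous_on[OF assms(1)]] by simp
  qed (use cont x0 in \<open>auto simp del: mem_ball\<close>)
  moreover have "at x0 within ball p r = at x0"
    using x0 by (intro at_within_open) auto
  moreover have "blinfun_apply (integral (cbox 0 1) (?fx x0)) = (\<lambda>v. ray_moment p (Suc m) (\<lambda>y. D y v) x0)"
    unfolding fun_eq_iff cbox_interval blinfun_apply_integral[OF int] ray_moment_def
    by (intro allI integral_cong apply_fx[OF x0])
  moreover have "ray_moment p m h = (\<lambda>x. integral (cbox 0 1) (?f x))"
    by (simp add: fun_eq_iff ray_moment_def)
  ultimately show ?thesis
    by (simp only: D_def)
qed

lemma smooth_on_ray_moment:
  fixes h :: "'e::euclidean_space \<Rightarrow> real"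
  assumes "smooth_on h (ball p r)"
  shows "smooth_on (ray_moment p m h) (ball p r)"
proof -
  have "C_k_on k (ray_moment p m h) (ball p r)" for k
    using assms
  proof (induction k arbitrary: m h)
    case 0
    then show ?case
      by (auto intro!: continuous_at_imp_continuous_on has_derivative_continuous
          ray_moment_has_derivative simp del: mem_ball)
  next
    case (Suc k)
    show ?case
      by (rule C_k_on_SucI[OF open_ball ray_moment_has_derivative[OF Suc.prems]])
        (auto intro: Suc.IH smooth_on_frechet_derivative[OF Suc.prems])
  qed
  then show ?thesis by (simp add: smooth_on_def)
qed

text \<open>
  Hadamard's lemma: integrate the derivative of \<open>h\<close> along the ray from \<open>p\<close> to \<open>x\<close>.
\<close>

lemma smooth_first_order_expansion:
  fixes h :: "'e::euclidean_space \<Rightarrow> real"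
  assumes h: "smooth_on h (ball p r)" and "r > 0"
  obtains G where "\<And>b. smooth_on (G b) (ball p r)" "\<And>b. G b p = frechet_derivative h (at p) b"
    "\<And>x. x \<in> ball p r \<Longrightarrow> h x = h p + (\<Sum>b\<in>Basis. ((x - p) \<bullet> b) * G b x)"
proof
  let ?G = "\<lambda>b. ray_moment p 0 (\<lambda>y. frechet_derivative h (at y) b)"
  show "smooth_on (?G b) (ball p r)" for b
    by (intro smooth_on_ray_moment smooth_on_frechet_derivative h)
  show "?G b p = frechet_derivative h (at p) b" for b
    by (simp add: ray_moment_def)
  fix x assume x: "x \<in> ball p r"
  let ?D = "\<lambda>t. frechet_derivative h (at (p + t *\<^sub>R (x - p)))"
  have lin: "linear (?D t)" if "t \<in> {0..1}" for t
    using smooth_on_has_derivative[OF h ray_in_ball[OF x]] has_derivative_linear that by fastforce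
  have "((\<lambda>t. ?D t (x - p)) has_integral h (p + 1 *\<^sub>R (x - p)) - h (p + 0 *\<^sub>R (x - p))) {0..1}"
  proof (rule fundamental_theorem_of_calculus)
    fix t :: real assume t: "t \<in> {0..1}"
    have ray: "((\<lambda>t. p + t *\<^sub>R (x - p)) has_derivative (\<lambda>s. s *\<^sub>R (x - p))) (at t)"
      by (auto intro!: derivative_eq_intros)
    have "((\<lambda>t. h (p + t *\<^sub>R (x - p))) has_derivative (\<lambda>s. ?D t (s *\<^sub>R (x - p)))) (at t)"
      using has_derivative_compose[OF ray smooth_on_has_derivative[OF h ray_in_ball[OF x]]] t by simp
    then show "((\<lambda>t. h (p + t *\<^sub>R (x - p))) has_vector_derivative ?D t (x - p)) (at t within {0..1})"
      by (simp add: has_vector_derivative_def has_derivative_at_withinI linear_cmul[OF lin[OF t]])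
  qed simp
  then have "h x - h p = integral {0..1} (\<lambda>t. ?D t (x - p))"
    by (simp add: integral_unique)
  also have "\<dots> = integral {0..1} (\<lambda>t. \<Sum>b\<in>Basis. ((x - p) \<bullet> b) * ?D t b)"
  proof (rule integral_cong)
    fix t :: real assume t: "t \<in> {0..1}"
    have "?D t (x - p) = ?D t (\<Sum>b\<in>Basis. ((x - p) \<bullet> b) *\<^sub>R b)"
      by (simp only: euclidean_representation)
    then show "?D t (x - p) = (\<Sum>b\<in>Basis. ((x - p) \<bullet> b) * ?D t b)"
      by (simp only: linear_sum[OF lin[OF t]] linear_cmul[OF lin[OF t]] real_scaleR_def)
  qed
  also have "\<dots> = (\<Sum>b\<in>Basis. ((x - p) \<bullet> b) * ?G b x)"
  proof -
    have "(\<lambda>t. ?D t b) integrable_on {0..1}" for b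
      using integrable_along_ray[OF smooth_on_continuous_on[OF smooth_on_frechet_derivative[OF h]] x,
          where m = 0] by simp
    then show ?thesis
      by (subst integral_sum) (auto simp: ray_moment_def intro!: integrable_on_mult_right)
  qed
  finally show "h x = h p + (\<Sum>b\<in>Basis. ((x - p) \<bullet> b) * ?G b x)" by simp
qed


section \<open>Smooth functions on a manifold\<close>

text \<open>
  The support condition makes the values of \<open>h\<close> off \<open>W\<close> immaterial: \<open>W\<close> and the complement of \<open>K\<close>
  are an open cover, and on the latter the product vanishes.
\<close>

lemma smooth_on_mult_extend:
  fixes h \<beta> :: "'e::euclidean_space \<Rightarrow> real"
  assumes "open W" "smooth_on h W" "smooth_on \<beta> UNIV" "closed K" "K \<subseteq> W"
    and "\<And>x. x \<notin> K \<Longrightarrow> \<beta> x = 0"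
  shows "smooth_on (\<lambda>x. \<beta> x * h x) UNIV"
proof -
  have "smooth_on (\<lambda>x. \<beta> x * h x) (- K)"
    by (rule smooth_on_cong[OF _ _ smooth_on_const[of _ 0]]) (use assms in auto)
  moreover have "smooth_on (\<lambda>x. \<beta> x * h x) W"
    by (intro smooth_on_mult smooth_on_subset[OF assms(3)] assms) auto
  moreover have "W \<union> - K = UNIV" using \<open>K \<subseteq> W\<close> by auto
  ultimately show ?thesis
    using smooth_on_Un[of W "- K"] assms by (metis open_Compl)
qed

lemma smooth_manifold_chart:
  assumes "smooth_manifold A" "(U, \<kappa>) \<in> A"
  shows "open U" "open (\<kappa> ` U)" "homeomorphism U (\<kappa> ` U) \<kappa> (inv_into U \<kappa>)"
  using assms by (auto simp: smooth_manifold_def is_chart_def)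

lemma smooth_manifold_chart_inv [simp]:
  assumes "smooth_manifold A" "(U, \<kappa>) \<in> A" "q \<in> U"
  shows "inv_into U \<kappa> (\<kappa> q) = q"
  using smooth_manifold_chart(3)[OF assms(1,2)] assms(3) by (auto simp: homeomorphism_def)

lemma smooth_manifold_chart_open_image:
  assumes "smooth_manifold A" "(U, \<kappa>) \<in> A" "open W"
  shows "open (\<kappa> ` (U \<inter> W))"
proof -
  note ch = smooth_manifold_chart[OF assms(1,2)]
  have "openin (top_of_set (\<kappa> ` U)) (\<kappa> ` (U \<inter> W))"
    using homeomorphism_imp_open_map[OF ch(3), of "U \<inter> W"] assms(3) by auto
  with ch(2) show ?thesis by (simp add: openin_open_eq)
qed

lemma smooth_fun_const:
  "smooth_manifold A \<Longrightarrow> smooth_fun A (\<lambda>q. c)"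
  by (auto simp: smooth_fun_def comp_def intro: smooth_on_const smooth_manifold_chart)

lemma smooth_fun_add:
  "smooth_manifold A \<Longrightarrow> smooth_fun A f \<Longrightarrow> smooth_fun A h \<Longrightarrow> smooth_fun A (\<lambda>q. f q + h q)"
  by (fastforce simp: smooth_fun_def comp_def intro: smooth_on_add smooth_manifold_chart)

lemma smooth_fun_mult:
  "smooth_manifold A \<Longrightarrow> smooth_fun A f \<Longrightarrow> smooth_fun A h \<Longrightarrow> smooth_fun A (\<lambda>q. f q * h q)"
  by (fastforce simp: smooth_fun_def comp_def intro: smooth_on_mult smooth_manifold_chart)

lemma smooth_fun_sum:
  "smooth_manifold A \<Longrightarrow> (\<And>i. i \<in> I \<Longrightarrow> smooth_fun A (f i)) \<Longrightarrow> smooth_fun A (\<lambda>q. \<Sum>i\<in>I. f i q)"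
  by (induction I rule: infinite_finite_induct) (auto intro: smooth_fun_const smooth_fun_add)

text \<open>
  The support of \<open>h\<close> corresponds to a compact, hence closed, subset of the manifold, which is
  where the Hausdorff property enters: off that set the extended function vanishes on an open set.
\<close>

lemma smooth_fun_extend_by_zero:
  fixes A :: "('m::{t2_space, second_countable_topology}, 'e::euclidean_space) chart set"
  assumes A: "smooth_manifold A" and U: "(U, \<kappa>) \<in> A"
    and "smooth_on h UNIV" "compact K" "K \<subseteq> \<kappa> ` U" and zero: "\<And>x. x \<notin> K \<Longrightarrow> h x = 0"
  shows "smooth_fun A (\<lambda>q. if q \<in> U then h (\<kappa> q) else 0)"
  unfolding smooth_fun_def
proof clarify
  fix V \<theta> assume V: "(V, \<theta>) \<in> A"
  let ?F = "(\<lambda>q. if q \<in> U then h (\<kappa> q) else 0) \<circ> inv_into V \<theta>"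
  define C where "C = inv_into U \<kappa> ` K"
  have "compact C"
    unfolding C_def using smooth_manifold_chart(3)[OF A U] assms(4,5)
    by (auto simp: homeomorphism_def intro: compact_continuous_image continuous_on_subset)
  then have "open (- C)" by (simp add: compact_imp_closed open_Compl)
  have off: "h (\<kappa> q) = 0" if "q \<in> U" "q \<notin> C" for q
    using that zero[of "\<kappa> q"] smooth_manifold_chart_inv[OF A U] by (force simp: C_def)
  have 1: "smooth_on ?F (\<theta> ` (V \<inter> U))"
  proof (rule smooth_on_cong)
    show op: "open (\<theta> ` (V \<inter> U))"
      by (rule smooth_manifold_chart_open_image[OF A V smooth_manifold_chart(1)[OF A U]])
    have "smooth_on (\<kappa> \<circ> inv_into V \<theta>) (\<theta> ` (V \<inter> U))"
      using A U V unfolding smooth_manifold_def by blast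
    from smooth_on_compose[OF op open_UNIV _ this assms(3)]
    show "smooth_on (\<lambda>x. h ((\<kappa> \<circ> inv_into V \<theta>) x)) (\<theta> ` (V \<inter> U))" by simp
  qed (auto simp: smooth_manifold_chart_inv[OF A V])
  have 2: "smooth_on ?F (\<theta> ` (V \<inter> - C))"
  proof (rule smooth_on_cong)
    show op: "open (\<theta> ` (V \<inter> - C))"
      by (rule smooth_manifold_chart_open_image[OF A V \<open>open (- C)\<close>])
    show "smooth_on (\<lambda>x. 0) (\<theta> ` (V \<inter> - C))" by (rule smooth_on_const[OF op])
  qed (auto simp: smooth_manifold_chart_inv[OF A V] off)
  have "C \<subseteq> U"
    using assms(5) smooth_manifold_chart_inv[OF A U] by (force simp: C_def)
  then have "\<theta> ` V = \<theta> ` (V \<inter> U) \<union> \<theta> ` (V \<inter> - C)" by blast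
  with smooth_on_Un[OF _ _ 1 2] show "smooth_on ?F (\<theta> ` V)"
    using smooth_manifold_chart_open_image[OF A V \<open>open (- C)\<close>]
      smooth_manifold_chart_open_image[OF A V smooth_manifold_chart(1)[OF A U]] by simp
qed


section \<open>Tangent spaces\<close>

lemma tangent_space_subspace: "subspace (tangent_space A p)"
  by (rule subspaceI) (auto simp: tangent_space_def scaleR_fun_def algebra_simps)

lemma tangent_space_add:
  "v \<in> tangent_space A p \<Longrightarrow> smooth_fun A f \<Longrightarrow> smooth_fun A h
    \<Longrightarrow> v (\<lambda>q. f q + h q) = v f + v h"
  by (simp add: tangent_space_def)

lemma tangent_space_mult:
  "v \<in> tangent_space A p \<Longrightarrow> smooth_fun A f \<Longrightarrow> smooth_fun A h
    \<Longrightarrow> v (\<lambda>q. f q * h q) = f p * v h + h p * v f"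
  by (simp add: tangent_space_def)

lemma tangent_space_scale:
  "v \<in> tangent_space A p \<Longrightarrow> smooth_fun A f \<Longrightarrow> v (\<lambda>q. r * f q) = r * v f"
  by (simp add: tangent_space_def)

lemma tangent_space_const:
  assumes "smooth_manifold A" "v \<in> tangent_space A p"
  shows "v (\<lambda>q. c) = 0"
proof -
  have "v (\<lambda>q. 1) = 0"
    using tangent_space_mult[OF assms(2) smooth_fun_const[OF assms(1)] smooth_fun_const[OF assms(1)],
        of 1 1] by simp
  with tangent_space_scale[OF assms(2) smooth_fun_const[OF assms(1)], of c 1] show ?thesis by simp
qed

lemma tangent_space_sum:
  assumes "smooth_manifold A" "v \<in> tangent_space A p" "\<And>i. i \<in> I \<Longrightarrow> smooth_fun A (f i)"
  shows "v (\<lambda>q. \<Sum>i\<in>I. f i q) = (\<Sum>i\<in>I. v (f i))"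
  using assms(3)
proof (induction I rule: infinite_finite_induct)
  case (insert i I)
  then have "v (\<lambda>q. f i q + (\<Sum>i\<in>I. f i q)) = v (f i) + v (\<lambda>q. \<Sum>i\<in>I. f i q)"
    by (intro tangent_space_add[OF assms(2)] smooth_fun_sum[OF assms(1)]) auto
  with insert show ?case by simp
qed (auto simp: tangent_space_const[OF assms(1,2)])

text \<open>
  A chart around \<open>p\<close> with a bump function, by which functions and vector fields given in the
  chart are made global. The factor 2 leaves room between the support of the bump function and the
  ball on which the first order expansion is available.
\<close>

locale chart_around =
  fixes A :: "('m::{t2_space, second_countable_topology}, 'e::euclidean_space) chart set"
    and U :: "'m set" and \<kappa> :: "'m \<Rightarrow> 'e" and p :: 'm and r :: real and \<beta> :: "'e \<Rightarrow> real"
  assumes A: "smooth_manifold A" and U: "(U, \<kappa>) \<in> A" and p: "p \<in> U"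
    and r: "r > 0" and ball: "ball (\<kappa> p) (2 * r) \<subseteq> \<kappa> ` U"
    and \<beta>: "smooth_on \<beta> UNIV" "\<beta> (\<kappa> p) = 1" and \<beta>_0: "x \<notin> cball (\<kappa> p) r \<Longrightarrow> \<beta> x = 0"

lemma chart_around_exists:
  assumes "smooth_manifold (A :: ('m::{t2_space, second_countable_topology}, 'e::euclidean_space) chart set)"
  obtains U \<kappa> r \<beta> where "chart_around A U \<kappa> p r \<beta>"
proof -
  obtain U \<kappa> where U: "(U, \<kappa>) \<in> A" "p \<in> U"
    using assms unfolding smooth_manifold_def by blast
  then obtain s where s: "s > 0" "ball (\<kappa> p) s \<subseteq> \<kappa> ` U"
    using smooth_manifold_chart(2)[OF assms U(1)] open_contains_ball by blast
  obtain \<beta> :: "'e \<Rightarrow> real" where "smooth_on \<beta> UNIV" "\<beta> (\<kappa> p) = 1"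
    "\<And>x. x \<notin> cball (\<kappa> p) (s / 2) \<Longrightarrow> \<beta> x = 0"
    using smooth_bump_exists[OF half_gt_zero[OF s(1)]] by blast
  with U s assms have "chart_around A U \<kappa> p (s / 2) \<beta>"
    by unfold_locales auto
  then show ?thesis by (rule that)
qed

context chart_around
begin

lemma inv_chart [simp]: "q \<in> U \<Longrightarrow> inv_into U \<kappa> (\<kappa> q) = q"
  by (rule smooth_manifold_chart_inv[OF A U])

lemma cball_subset: "cball (\<kappa> p) r \<subseteq> ball (\<kappa> p) (2 * r)"
  using r by (auto simp: subset_eq)

lemma smooth_on_chart: "smooth_fun A f \<Longrightarrow> smooth_on (f \<circ> inv_into U \<kappa>) (\<kappa> ` U)"
  using U by (auto simp: smooth_fun_def)

lemma chart_has_derivative: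
  assumes "smooth_fun A f" "q \<in> U"
  shows "(f \<circ> inv_into U \<kappa> has_derivative frechet_derivative (f \<circ> inv_into U \<kappa>) (at (\<kappa> q))) (at (\<kappa> q))"
  by (rule smooth_on_has_derivative[OF smooth_on_chart]) (use assms in auto)

text \<open>
  The directional derivative \<open>\<partial>\<^sub>u\<close> at \<open>q\<close> in the given chart.
\<close>

definition chart_deriv :: "'m \<Rightarrow> 'e \<Rightarrow> 'm tvec" where
  "chart_deriv q u f =
     (if smooth_fun A f then frechet_derivative (f \<circ> inv_into U \<kappa>) (at (\<kappa> q)) u else 0)"

definition localize :: "('e \<Rightarrow> real) \<Rightarrow> 'm \<Rightarrow> real" where
  "localize h q = (if q \<in> U then \<beta> (\<kappa> q) * h (\<kappa> q) else 0)"

definition chart_field :: "'e \<Rightarrow> 'm vfield" where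
  "chart_field u q = (if q \<in> U then \<beta> (\<kappa> q) *\<^sub>R chart_deriv q u else 0)"

lemma smooth_fun_localize:
  assumes "open W" "cball (\<kappa> p) r \<subseteq> W" "smooth_on h W"
  shows "smooth_fun A (localize h)"
proof -
  have "smooth_on (\<lambda>x. \<beta> x * h x) UNIV"
    by (rule smooth_on_mult_extend[OF assms(1,3) \<beta>(1) closed_cball assms(2) \<beta>_0])
  then have "smooth_fun A (\<lambda>q. if q \<in> U then \<beta> (\<kappa> q) * h (\<kappa> q) else 0)"
    by (rule smooth_fun_extend_by_zero[OF A U _ compact_cball order.trans[OF cball_subset ball]])
      (simp add: \<beta>_0 del: mem_cball)
  then show ?thesis by (simp add: localize_def[abs_def])
qed

lemma linear_chart_deriv: "q \<in> U \<Longrightarrow> linear (chart_deriv q)"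
  using has_derivative_linear[OF chart_has_derivative]
  by (intro linearI) (auto simp: fun_eq_iff chart_deriv_def scaleR_fun_def linear_add linear_cmul)

lemma chart_deriv_eqI:
  assumes "smooth_fun A f" "(f \<circ> inv_into U \<kappa> has_derivative D) (at (\<kappa> q))"
  shows "chart_deriv q u f = D u"
  using frechet_derivative_at[OF assms(2)] assms(1) by (simp add: chart_deriv_def)

lemma chart_deriv_tangent:
  assumes q: "q \<in> U"
  shows "chart_deriv q u \<in> tangent_space A q"
  unfolding tangent_space_def
proof (intro CollectI conjI allI impI)
  fix f h assume f: "smooth_fun A f" and h: "smooth_fun A h"
  note d = chart_has_derivative[OF f q] chart_has_derivative[OF h q]
  have e: "chart_deriv q u f = frechet_derivative (f \<circ> inv_into U \<kappa>) (at (\<kappa> q)) u"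
    "chart_deriv q u h = frechet_derivative (h \<circ> inv_into U \<kappa>) (at (\<kappa> q)) u"
    using f h by (auto simp: chart_deriv_def)
  show "chart_deriv q u (\<lambda>x. f x + h x) = chart_deriv q u f + chart_deriv q u h"
    unfolding e by (rule chart_deriv_eqI[OF smooth_fun_add[OF A f h]])
      (use has_derivative_add[OF d] in \<open>simp add: comp_def\<close>)
  show "chart_deriv q u (\<lambda>x. f x * h x) = f q * chart_deriv q u h + h q * chart_deriv q u f"
    unfolding e by (rule chart_deriv_eqI[OF smooth_fun_mult[OF A f h]])
      (use has_derivative_mult[OF d] q in \<open>simp add: comp_def mult.commute\<close>)
next
  fix s f assume f: "smooth_fun A f"
  have e: "chart_deriv q u f = frechet_derivative (f \<circ> inv_into U \<kappa>) (at (\<kappa> q)) u"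
    using f by (auto simp: chart_deriv_def)
  show "chart_deriv q u (\<lambda>x. s * f x) = s * chart_deriv q u f"
    unfolding e by (rule chart_deriv_eqI[OF smooth_fun_mult[OF A smooth_fun_const[OF A] f]])
      (use has_derivative_mult_right[OF chart_has_derivative[OF f q], of s] in \<open>simp add: comp_def\<close>)
qed (simp add: chart_deriv_def)

lemma chart_field_at: "chart_field u p = chart_deriv p u"
  using p \<beta>(2) by (simp add: chart_field_def)

lemma vector_field_chart_field: "vector_field A (chart_field u)"
  unfolding vector_field_def
proof (intro conjI allI impI)
  show "chart_field u q \<in> tangent_space A q" for q
    unfolding chart_field_def
    using subspace_scale[OF tangent_space_subspace chart_deriv_tangent]
      subspace_0[OF tangent_space_subspace] by metis
  fix f assume f: "smooth_fun A f"
  have "(\<lambda>q. chart_field u q f) = localize (\<lambda>x. frechet_derivative (f \<circ> inv_into U \<kappa>) (at x) u)"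
    using f by (auto simp: fun_eq_iff chart_field_def localize_def chart_deriv_def scaleR_fun_def)
  moreover have "smooth_fun A \<dots>"
    by (rule smooth_fun_localize[OF smooth_manifold_chart(2)[OF A U] order.trans[OF cball_subset ball]
          smooth_on_frechet_derivative[OF smooth_on_chart[OF f]]])
  ultimately show "smooth_fun A (\<lambda>q. chart_field u q f)" by simp
qed

definition coord :: "'e \<Rightarrow> 'm \<Rightarrow> real" where
  "coord b = localize (\<lambda>x. (x - \<kappa> p) \<bullet> b)"

lemma smooth_fun_coord: "smooth_fun A (coord b)"
  unfolding coord_def
  by (rule smooth_fun_localize[of UNIV])
    (auto intro!: smooth_on_inner smooth_on_diff smooth_on_ident smooth_on_const)

lemma chart_deriv_coord: "chart_deriv p u (coord b) = u \<bullet> b"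
proof (rule chart_deriv_eqI[OF smooth_fun_coord])
  have "((\<lambda>x. \<beta> x * ((x - \<kappa> p) \<bullet> b)) has_derivative
      (\<lambda>u. \<beta> (\<kappa> p) * (u \<bullet> b) + frechet_derivative \<beta> (at (\<kappa> p)) u * ((\<kappa> p - \<kappa> p) \<bullet> b))) (at (\<kappa> p))"
    by (intro has_derivative_mult smooth_on_has_derivative[OF \<beta>(1)]) (auto intro!: derivative_eq_intros)
  then have "((\<lambda>x. \<beta> x * ((x - \<kappa> p) \<bullet> b)) has_derivative (\<lambda>u. u \<bullet> b)) (at (\<kappa> p))"
    by (simp add: \<beta>)
  then show "(coord b \<circ> inv_into U \<kappa> has_derivative (\<lambda>u. u \<bullet> b)) (at (\<kappa> p))"
    by (rule has_derivative_transform_within_open[OF _ smooth_manifold_chart(2)[OF A U]])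
      (use p in \<open>auto simp: coord_def localize_def\<close>)
qed

lemma inj_chart_deriv: "inj (chart_deriv p)"
proof (rule injI)
  fix u u' assume "chart_deriv p u = chart_deriv p u'"
  then have eq: "chart_deriv p u (coord b) = chart_deriv p u' (coord b)" for b
    by (rule arg_cong[where f = "\<lambda>v. v (coord b)"])
  show "u = u'"
    by (rule euclidean_eqI) (use eq in \<open>simp only: chart_deriv_coord\<close>)
qed

text \<open>
  Multiplied by the square of the bump function, the first order expansion of \<open>f\<close> in the chart
  becomes an identity between smooth functions on the whole manifold; a derivation at \<open>p\<close> is
  evaluated on both sides of it by the product rule alone.
\<close>

lemma tangent_eq_chart_deriv:
  assumes v: "v \<in> tangent_space A p"
  shows "v = chart_deriv p (\<Sum>b\<in>Basis. v (coord b) *\<^sub>R b)"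
proof
  fix f
  show "v f = chart_deriv p (\<Sum>b\<in>Basis. v (coord b) *\<^sub>R b) f"
  proof (cases "smooth_fun A f")
    case False
    then show ?thesis using v by (simp add: chart_deriv_def tangent_space_def)
  next
    case f: True
    define h where "h = f \<circ> inv_into U \<kappa>"
    have h_ball: "smooth_on h (ball (\<kappa> p) (2 * r))"
      unfolding h_def by (rule smooth_on_subset[OF smooth_on_chart[OF f] ball])
    obtain G where G: "\<And>b. smooth_on (G b) (ball (\<kappa> p) (2 * r))"
      "\<And>b. G b (\<kappa> p) = frechet_derivative h (at (\<kappa> p)) b"
      "\<And>x. x \<in> ball (\<kappa> p) (2 * r) \<Longrightarrow> h x = h (\<kappa> p) + (\<Sum>b\<in>Basis. ((x - \<kappa> p) \<bullet> b) * G b x)"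
      using smooth_first_order_expansion[OF h_ball mult_pos_pos[OF zero_less_numeral r]] by blast
    define one where "one = localize (\<lambda>x. 1)"
    define \<Gamma> where "\<Gamma> b = localize (G b)" for b
    have one: "smooth_fun A one"
      unfolding one_def by (rule smooth_fun_localize[of UNIV]) (auto intro: smooth_on_const)
    have \<Gamma>: "smooth_fun A (\<Gamma> b)" for b
      unfolding \<Gamma>_def by (rule smooth_fun_localize[OF open_ball cball_subset G(1)])
    have at_p: "one p = 1" "\<Gamma> b p = frechet_derivative h (at (\<kappa> p)) b" "coord b p = 0" for b
      using p \<beta>(2) G(2) by (auto simp: one_def \<Gamma>_def coord_def localize_def)
    have "one q * one q * f q = f p * (one q * one q) + (\<Sum>b\<in>Basis. coord b q * \<Gamma> b q)" for q
    proof (cases "q \<in> U \<and> \<kappa> q \<in> cball (\<kappa> p) r")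
      case True
      then have "f q = f p + (\<Sum>b\<in>Basis. ((\<kappa> q - \<kappa> p) \<bullet> b) * G b (\<kappa> q))"
        using G(3)[of "\<kappa> q"] cball_subset p by (auto simp: h_def)
      with True show ?thesis
        by (simp add: one_def coord_def \<Gamma>_def localize_def algebra_simps sum_distrib_left)
    next
      case False
      then show ?thesis
        using \<beta>_0[of "\<kappa> q"] by (auto simp: one_def coord_def \<Gamma>_def localize_def)
    qed
    then have "v (\<lambda>q. one q * one q * f q)
        = v (\<lambda>q. f p * (one q * one q) + (\<Sum>b\<in>Basis. coord b q * \<Gamma> b q))"
      by simp
    also have "\<dots> = f p * v (\<lambda>q. one q * one q) + (\<Sum>b\<in>Basis. v (\<lambda>q. coord b q * \<Gamma> b q))"
      by (simp add: tangent_space_add[OF v] tangent_space_scale[OF v] tangent_space_sum[OF A v]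
          smooth_fun_mult[OF A] smooth_fun_sum[OF A] smooth_fun_const[OF A] one \<Gamma> smooth_fun_coord)
    also have "\<dots> = f p * v (\<lambda>q. one q * one q)
        + (\<Sum>b\<in>Basis. frechet_derivative h (at (\<kappa> p)) b * v (coord b))"
      by (simp add: tangent_space_mult[OF v smooth_fun_coord \<Gamma>] at_p)
    also have "v (\<lambda>q. one q * one q * f q) = v f + f p * v (\<lambda>q. one q * one q)"
      by (simp add: tangent_space_mult[OF v smooth_fun_mult[OF A one one] f] at_p)
    finally have "v f = (\<Sum>b\<in>Basis. v (coord b) * frechet_derivative h (at (\<kappa> p)) b)"
      by (simp add: mult.commute)
    moreover have "linear (frechet_derivative h (at (\<kappa> p)))"
      using has_derivative_linear[OF chart_has_derivative[OF f p]] by (simp add: h_def)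
    ultimately show ?thesis
      using f by (simp add: chart_deriv_def h_def linear_sum linear_cmul)
  qed
qed

lemma range_chart_deriv: "range (chart_deriv p) = tangent_space A p"
  using chart_deriv_tangent[OF p] tangent_eq_chart_deriv by (auto simp: image_iff) 

end

text \<open>
  A derivation is \<open>\<partial>\<^sub>u\<close> for some \<open>u\<close>, and the cut off coordinate field in the direction \<open>u\<close>
  extends it, since the bump function is 1 at \<open>p\<close>.
\<close>

lemma vector_field_through_exists:
  assumes "smooth_manifold A" "v \<in> tangent_space A p"
  shows "\<exists>X. vector_field A X \<and> X p = v"
proof -
  obtain U \<kappa> r \<beta> where "chart_around A U \<kappa> p r \<beta>"
    using chart_around_exists[OF assms(1)] by blast
  then interpret chart_around A U \<kappa> p r \<beta> .
  from assms(2) obtain u where "v = chart_deriv p u" using range_chart_deriv by blast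
  with vector_field_chart_field chart_field_at show ?thesis by metis
qed

text \<open>
  \<open>u \<mapsto> \<partial>\<^sub>u\<close> is a linear isomorphism of the model space onto the tangent space. The second claim
  concerns all bases, because the trace is defined with an unspecified one.
\<close>

lemma tangent_space_basis:
  fixes A :: "('m::{t2_space, second_countable_topology}, 'e::euclidean_space) chart set"
  assumes "smooth_manifold A"
  shows "\<exists>B. independent B \<and> span B = tangent_space A p"
    and "independent B \<Longrightarrow> span B = tangent_space A p \<Longrightarrow> finite B \<and> card B = DIM('e)"
proof -
  obtain U \<kappa> r \<beta> where "chart_around A U \<kappa> p r \<beta>"
    using chart_around_exists[OF assms(1)] by blast
  then interpret chart_around A U \<kappa> p r \<beta> .
  let ?C = "chart_deriv p ` Basis"
  have lin: "linear (chart_deriv p)" by (rule linear_chart_deriv[OF p])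
  have C: "independent ?C" "span ?C = tangent_space A p"
    using linear_independent_injective_image[OF lin independent_Basis
        inj_on_subset[OF inj_chart_deriv subset_UNIV]]
      linear_span_image[OF lin, of Basis] range_chart_deriv by auto
  have "card ?C = DIM('e)"
    by (rule card_image) (rule inj_on_subset[OF inj_chart_deriv subset_UNIV])
  with C show "\<exists>B. independent B \<and> span B = tangent_space A p" by blast
  assume B: "independent B" "span B = tangent_space A p"
  have "finite ?C" by simp
  with B C have "finite B \<and> card B \<le> card ?C" 
    using independent_span_bound[of ?C B] span_superset by metis
  moreover from this B C have "card ?C \<le> card B" 
    using independent_span_bound[of B ?C] span_superset by metis
  ultimately show "finite B \<and> card B = DIM('e)" using \<open>card ?C = DIM('e)\<close> by simp
qed


section \<open>Traces\<close>

lemma linear_map_on_diff: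
  assumes lin: "linear_map_on V h" and "subspace V" and u: "u \<in> V" and v: "v \<in> V"
  shows "h (u - v) = h u - h v"
proof -
  have "h (u + (-1) *\<^sub>R v) = h u + h ((-1) *\<^sub>R v)"
    using lin u subspace_scale[OF \<open>subspace V\<close> v] by (simp only: linear_map_on_def)
  also have "h ((-1) *\<^sub>R v) = (-1) *\<^sub>R h v"
    using lin v by (simp only: linear_map_on_def)
  finally show ?thesis by simp
qed

text \<open>
  In a basis the rank one part contributes \<open>\<Sum>\<^sub>b y\<^sub>b \<alpha>(b)\<close>, which is \<open>\<alpha>(y)\<close> by linearity.
\<close>

lemma trace_on_rank_one_minus_scalar:
  assumes basis: "\<exists>B. independent B \<and> span B = V"
    and card: "\<And>B. independent B \<Longrightarrow> span B = V \<Longrightarrow> finite B \<and> card B = n"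
    and \<alpha>: "linear_map_on V \<alpha>" and y: "y \<in> V"
    and h: "\<And>x. x \<in> V \<Longrightarrow> h x = \<alpha> x *\<^sub>R y - t *\<^sub>R x"
  shows "trace_on V h = \<alpha> y - t * real n"
proof -
  define B where "B = (SOME B. independent B \<and> span B = V)"
  have B: "independent B" "span B = V"
    using someI_ex[OF basis] by (auto simp: B_def)
  note fin = card[OF B]
  have "B \<subseteq> V" using B(2) span_superset by blast
  have add: "\<alpha> (u + v) = \<alpha> u + \<alpha> v" and scale: "\<alpha> (s *\<^sub>R u) = s * \<alpha> u" if "u \<in> V" "v \<in> V" for u v s
    using \<alpha> that by (auto simp: linear_map_on_def)
  have V: "subspace V" using B(2) subspace_span by blast
  have sum: "\<alpha> (\<Sum>b\<in>C. r b *\<^sub>R b) = (\<Sum>b\<in>C. r b * \<alpha> b)" if "finite C" "C \<subseteq> V" for C r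
    using that
  proof induction
    case empty
    show ?case using scale[OF y y, of 0] by simp
  next
    case (insert b C)
    then have "(\<Sum>b\<in>C. r b *\<^sub>R b) \<in> V" "b \<in> V"
      using V by (auto intro!: subspace_sum subspace_scale)
    with insert show ?case by (simp add: add scale subspace_scale[OF V])
  qed
  have rep: "representation B (h b) b = representation B y b * \<alpha> b - t" if "b \<in> B" for b
  proof -
    have "b \<in> V" using that \<open>B \<subseteq> V\<close> by blast
    then show ?thesis
      using B y that by (simp add: h representation_diff representation_scale subspace_scale[OF V]
          representation_basis)
  qed
  have "trace_on V h = (\<Sum>b\<in>B. representation B (h b) b)"
    unfolding trace_on_def B_def Let_def ..
  also have "\<dots> = (\<Sum>b\<in>B. representation B y b * \<alpha> b - t)"
    by (rule sum.cong[OF refl rep])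
  also have "\<dots> = (\<Sum>b\<in>B. representation B y b * \<alpha> b) - t * real n"
    using fin by (simp add: sum_subtractf)
  also have "(\<Sum>b\<in>B. representation B y b * \<alpha> b) = \<alpha> (\<Sum>b\<in>B. representation B y b *\<^sub>R b)"
    using sum[of B "representation B y"] fin \<open>B \<subseteq> V\<close> by simp
  also have "(\<Sum>b\<in>B. representation B y b *\<^sub>R b) = y"
    using sum_representation_eq[of B y B] B y fin by simp
  finally show ?thesis .
qed


section \<open>Geometry of the structure vector field\<close>

locale paracontact_levi_civita =
  fixes A :: "('m::{t2_space, second_countable_topology}, 'e::euclidean_space) chart set"
    and \<phi> :: "'m \<Rightarrow> 'm tvec \<Rightarrow> 'm tvec"
    and \<xi> :: "'m vfield"
    and \<eta> :: "'m \<Rightarrow> 'm tvec \<Rightarrow> real"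
    and g :: "'m \<Rightarrow> 'm tvec \<Rightarrow> 'm tvec \<Rightarrow> real"
    and \<epsilon> :: real
    and nabla :: "'m vfield \<Rightarrow> 'm vfield \<Rightarrow> 'm vfield"
  assumes manifold: "smooth_manifold A"
    and paracontact: "almost_paracontact_metric A \<phi> \<xi> \<eta> g \<epsilon>"
    and levi_civita: "levi_civita A g nabla"
begin

lemma structure_tensors:
  "tensor_field_1_1 A \<phi>" "one_form A \<eta>" "pseudo_riemannian_metric A g"
  using paracontact unfolding almost_paracontact_metric_def by - (elim conjE, assumption)+

lemma vector_field_at: "vector_field A X \<Longrightarrow> X p \<in> tangent_space A p"
  by (simp add: vector_field_def)

lemma xi: "vector_field A \<xi>"
  using paracontact unfolding almost_paracontact_metric_def by (elim conjE) blast

lemma xi_at: "\<xi> p \<in> tangent_space A p"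
  by (rule vector_field_at[OF xi])

lemma eta_xi: "\<eta> p (\<xi> p) = 1"
  using paracontact unfolding almost_paracontact_metric_def by (elim conjE) blast

lemma eps_square: "\<epsilon> * \<epsilon> = 1" "\<epsilon> * (\<epsilon> * x) = x"
proof -
  have "\<epsilon> \<in> {1, -1}" using paracontact unfolding almost_paracontact_metric_def by (elim conjE) blast
  then show "\<epsilon> * \<epsilon> = 1" "\<epsilon> * (\<epsilon> * x) = x" by auto
qed

lemma tangent_closed:
  "u \<in> tangent_space A p \<Longrightarrow> v \<in> tangent_space A p \<Longrightarrow> u + v \<in> tangent_space A p"
  "u \<in> tangent_space A p \<Longrightarrow> v \<in> tangent_space A p \<Longrightarrow> u - v \<in> tangent_space A p"
  "u \<in> tangent_space A p \<Longrightarrow> s *\<^sub>R u \<in> tangent_space A p"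
  by (rule subspace_add[OF tangent_space_subspace] subspace_diff[OF tangent_space_subspace]
      subspace_scale[OF tangent_space_subspace]; assumption)+

lemma linear_map_on_eta: "linear_map_on (tangent_space A p) (\<eta> p)"
  using structure_tensors(2) by (simp add: one_form_def)

lemma eta_linear:
  "u \<in> tangent_space A p \<Longrightarrow> v \<in> tangent_space A p \<Longrightarrow> \<eta> p (u + v) = \<eta> p u + \<eta> p v"
  "u \<in> tangent_space A p \<Longrightarrow> v \<in> tangent_space A p \<Longrightarrow> \<eta> p (u - v) = \<eta> p u - \<eta> p v"
  "u \<in> tangent_space A p \<Longrightarrow> \<eta> p (s *\<^sub>R u) = s * \<eta> p u"
  using linear_map_on_eta linear_map_on_diff[OF linear_map_on_eta tangent_space_subspace]
  by (auto simp: linear_map_on_def)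

lemma g_sym: "u \<in> tangent_space A p \<Longrightarrow> v \<in> tangent_space A p \<Longrightarrow> g p u v = g p v u"
  using structure_tensors(3) by (simp add: pseudo_riemannian_metric_def)

lemma linear_map_on_g: "x \<in> tangent_space A p \<Longrightarrow> linear_map_on (tangent_space A p) (\<lambda>v. g p v x)"
  using structure_tensors(3) by (simp add: pseudo_riemannian_metric_def tensor_field_0_2_def)

lemma g_left_linear:
  assumes x: "x \<in> tangent_space A p"
  shows "u \<in> tangent_space A p \<Longrightarrow> v \<in> tangent_space A p \<Longrightarrow> g p (u + v) x = g p u x + g p v x"
    "u \<in> tangent_space A p \<Longrightarrow> v \<in> tangent_space A p \<Longrightarrow> g p (u - v) x = g p u x - g p v x"
    "u \<in> tangent_space A p \<Longrightarrow> g p (s *\<^sub>R u) x = s * g p u x"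
  using linear_map_on_g[OF x] linear_map_on_diff[OF linear_map_on_g[OF x] tangent_space_subspace]
  by (auto simp: linear_map_on_def)

lemma g_right_linear:
  assumes x: "x \<in> tangent_space A p"
  shows "u \<in> tangent_space A p \<Longrightarrow> v \<in> tangent_space A p \<Longrightarrow> g p x (u + v) = g p x u + g p x v"
    "u \<in> tangent_space A p \<Longrightarrow> v \<in> tangent_space A p \<Longrightarrow> g p x (u - v) = g p x u - g p x v"
    "u \<in> tangent_space A p \<Longrightarrow> g p x (s *\<^sub>R u) = s * g p x u"
  by (simp_all add: g_sym[OF x] g_left_linear x tangent_closed)

lemma g_nondegenerate:
  "u \<in> tangent_space A p \<Longrightarrow> (\<And>v. v \<in> tangent_space A p \<Longrightarrow> g p u v = 0) \<Longrightarrow> u = 0"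
  using structure_tensors(3) by (simp add: pseudo_riemannian_metric_def)

lemma smooth_fun_g: "vector_field A X \<Longrightarrow> vector_field A Y \<Longrightarrow> smooth_fun A (\<lambda>p. g p (X p) (Y p))"
  using structure_tensors(3) by (simp add: pseudo_riemannian_metric_def tensor_field_0_2_def)

lemma smooth_fun_eta: "vector_field A X \<Longrightarrow> smooth_fun A (\<lambda>p. \<eta> p (X p))"
  using structure_tensors(2) by (simp add: one_form_def)

text \<open>
  As \<open>\<phi>\<close> annihilates \<open>\<xi>\<close>, the compatibility of the metric with \<open>\<phi>\<close> identifies \<open>\<epsilon> \<eta>\<close> as
  the form dual to \<open>\<xi>\<close>.
\<close>

lemma g_xi:
  assumes x: "x \<in> tangent_space A p"
  shows "g p x (\<xi> p) = \<epsilon> * \<eta> p x"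
proof -
  obtain X where X: "vector_field A X" "X p = x"
    using vector_field_through_exists[OF manifold x] by blast
  have "g p (\<phi> p (X p)) (\<phi> p (\<xi> p)) = g p (X p) (\<xi> p) - \<epsilon> * \<eta> p (X p) * \<eta> p (\<xi> p)"
    using paracontact X(1) xi unfolding almost_paracontact_metric_def by (elim conjE) blast
  moreover have "\<phi> p (\<xi> p) = 0"
    using paracontact unfolding almost_paracontact_metric_def by (elim conjE) blast
  moreover have "\<phi> p x \<in> tangent_space A p"
    using structure_tensors(1) x by (auto simp: tensor_field_1_1_def)
  ultimately show ?thesis
    using X(2) g_right_linear(3)[OF _ xi_at, of "\<phi> p x" p 0] by (simp add: eta_xi)
qed

lemma vector_field_add:
  "vector_field A X \<Longrightarrow> vector_field A Y \<Longrightarrow> vector_field A (X + Y)"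
  by (auto simp: vector_field_def intro!: tangent_closed smooth_fun_add[OF manifold])

lemma vector_field_fscale:
  "smooth_fun A s \<Longrightarrow> vector_field A X \<Longrightarrow> vector_field A (fscale s X)"
  unfolding vector_field_def
proof (intro conjI allI impI)
  assume s: "smooth_fun A s" and X: "(\<forall>p. X p \<in> tangent_space A p) \<and>
    (\<forall>f. smooth_fun A f \<longrightarrow> smooth_fun A (\<lambda>p. X p f))"
  show "fscale s X p \<in> tangent_space A p" for p
    using X tangent_closed(3) by (simp only: fscale_def)
  show "smooth_fun A (\<lambda>p. fscale s X p f)" if "smooth_fun A f" for f
    using X that by (simp add: fscale_def scaleR_fun_def smooth_fun_mult[OF manifold s])
qed

lemma connection: "affine_connection A nabla"
  using levi_civita by (simp only: levi_civita_def)

lemma vector_field_nabla: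
  "vector_field A X \<Longrightarrow> vector_field A Y \<Longrightarrow> vector_field A (nabla X Y)"
  by (rule connection[unfolded affine_connection_def, THEN conjunct1, rule_format])

lemma nabla_add:
  "vector_field A X \<Longrightarrow> vector_field A Y \<Longrightarrow> vector_field A Z
    \<Longrightarrow> nabla X (Y + Z) p = nabla X Y p + nabla X Z p"
  by (simp add: connection[unfolded affine_connection_def, THEN conjunct2, THEN conjunct1,
        rule_format, THEN conjunct2])

lemma nabla_fscale:
  "smooth_fun A s \<Longrightarrow> vector_field A X \<Longrightarrow> vector_field A Y
    \<Longrightarrow> nabla X (fscale s Y) p = X p s *\<^sub>R Y p + s p *\<^sub>R nabla X Y p"
  by (simp add: connection[unfolded affine_connection_def, THEN conjunct2, THEN conjunct2,
        rule_format, THEN conjunct2]) (simp add: fscale_def)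

lemma lie_bracket_at:
  "vector_field A X \<Longrightarrow> vector_field A Y \<Longrightarrow> lie_bracket X Y p = nabla X Y p - nabla Y X p"
  by (simp add: levi_civita[unfolded levi_civita_def, THEN conjunct2, THEN conjunct1, rule_format,
        symmetric])

lemma vector_field_lie_bracket:
  assumes "vector_field A X" "vector_field A Y"
  shows "vector_field A (lie_bracket X Y)"
proof -
  have "lie_bracket X Y = nabla X Y + fscale (\<lambda>_. -1) (nabla Y X)"
    by (rule ext) (simp add: lie_bracket_at[OF assms] fscale_def)
  then show ?thesis
    using assms by (simp add: vector_field_add vector_field_fscale vector_field_nabla
        smooth_fun_const[OF manifold])
qed

lemma metric_compatible:
  "vector_field A X \<Longrightarrow> vector_field A Y \<Longrightarrow> vector_field A Z
    \<Longrightarrow> X p (\<lambda>q. g q (Y q) (Z q)) = g p (nabla X Y p) (Z p) + g p (Y p) (nabla X Z p)"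
  by (rule levi_civita[unfolded levi_civita_def, THEN conjunct2, THEN conjunct2, rule_format])

text \<open>
  Written as \<open>\<epsilon> g(\<cdot>, \<xi>)\<close>, the form \<open>\<eta>\<close> is differentiated by compatibility with the metric.
\<close>

lemma deriv_eta:
  assumes X: "vector_field A X" and Y: "vector_field A Y"
  shows "X p (\<lambda>q. \<eta> q (Y q)) = \<eta> p (nabla X Y p) + \<epsilon> * g p (Y p) (nabla X \<xi> p)"
proof -
  have "(\<lambda>q. \<eta> q (Y q)) = (\<lambda>q. \<epsilon> * g q (Y q) (\<xi> q))"
    by (simp add: g_xi vector_field_at[OF Y] eps_square)
  then have "X p (\<lambda>q. \<eta> q (Y q)) = \<epsilon> * X p (\<lambda>q. g q (Y q) (\<xi> q))"
    using tangent_space_scale[OF vector_field_at[OF X] smooth_fun_g[OF Y xi]] by simp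
  then show ?thesis
    using vector_field_at[OF vector_field_nabla[OF X Y]]
    by (simp add: metric_compatible[OF X Y xi] g_xi eps_square distrib_left)
qed

lemma lie_derivative_metric_xi:
  assumes X: "vector_field A X" and Y: "vector_field A Y"
  shows "lie_derivative_metric \<xi> g X Y p = g p (nabla X \<xi> p) (Y p) + g p (X p) (nabla Y \<xi> p)"
proof -
  note vf = vector_field_at[OF X] vector_field_at[OF Y]
    vector_field_at[OF vector_field_nabla[OF X xi]] vector_field_at[OF vector_field_nabla[OF Y xi]]
    vector_field_at[OF vector_field_nabla[OF xi X]] vector_field_at[OF vector_field_nabla[OF xi Y]]
  show ?thesis
    by (simp add: lie_derivative_metric_def metric_compatible[OF xi X Y] lie_bracket_at X Y xi
        g_left_linear g_right_linear vf)
qed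

text \<open>
  The length of \<open>\<xi>\<close> is constant, so \<open>\<nabla>\<^sub>X\<xi>\<close> is orthogonal to \<open>\<xi>\<close>, and this determines the
  form \<open>w\<close>.
\<close>

lemma torse_forming_nabla:
  assumes tf: "torse_forming A nabla \<xi> f w" and X: "vector_field A X"
  shows "nabla X \<xi> p = f p *\<^sub>R (X p - \<eta> p (X p) *\<^sub>R \<xi> p)"
proof -
  note vf = vector_field_at[OF X] vector_field_at[OF vector_field_nabla[OF X xi]]
  have nab: "nabla X \<xi> p = f p *\<^sub>R X p + w p (X p) *\<^sub>R \<xi> p"
    using tf X by (simp add: torse_forming_def fscale_def)
  have "X p (\<lambda>q. g q (\<xi> q) (\<xi> q)) = 0"
    using tangent_space_const[OF manifold vector_field_at[OF X]] by (simp add: g_xi xi_at eta_xi)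
  then have "\<epsilon> * \<eta> p (nabla X \<xi> p) = 0"
    using metric_compatible[OF X xi xi] by (simp add: g_sym[OF xi_at] g_xi vf)
  then have "\<epsilon> * (\<epsilon> * (f p * \<eta> p (X p) + w p (X p))) = 0"
    by (simp add: nab eta_linear vf tangent_closed xi_at eta_xi)
  then have "w p (X p) = - f p * \<eta> p (X p)" by (simp only: eps_square)
  then show ?thesis by (simp add: nab scaleR_right_diff_distrib)
qed

text \<open>
  The Lie derivative is \<open>2f (g - \<epsilon> \<eta> \<otimes> \<eta>)\<close>, so the soliton equation is a linear relation
  between \<open>g\<close> and \<open>\<eta> \<otimes> \<eta>\<close>. Evaluated on \<open>\<xi>\<close> it fixes the coefficient of \<open>\<eta> \<otimes> \<eta>\<close>;
  what remains is the coefficient of \<open>g\<close> times \<open>g\<close> projected to the complement of \<open>\<xi>\<close>, and \<open>g\<close>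
  is nondegenerate.
\<close>

lemma torse_forming_soliton:
  assumes tf: "torse_forming A nabla \<xi> f w"
    and ein: "eta_Einstein A \<eta> g nabla a c"
    and sol: "eta_Ricci_soliton A \<eta> g nabla \<xi> lam \<mu>"
  shows "a + lam + \<epsilon> * (c + \<mu>) = 0"
    and "x \<in> tangent_space A p \<Longrightarrow> (f p + a + lam) *\<^sub>R (x - \<eta> p x *\<^sub>R \<xi> p) = 0"
proof -
  have eq: "(f p + a + lam) * g p x y + (c + \<mu> - \<epsilon> * f p) * (\<eta> p x * \<eta> p y) = 0"
    if x: "x \<in> tangent_space A p" and y: "y \<in> tangent_space A p" for p x y
  proof -
    obtain X Y where X: "vector_field A X" "X p = x" and Y: "vector_field A Y" "Y p = y"
      using vector_field_through_exists[OF manifold] x y by metis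
    have "1 / 2 * lie_derivative_metric \<xi> g X Y p + ricci A nabla X Y p
        + lam * g p (X p) (Y p) + \<mu> * (\<eta> p (X p) * \<eta> p (Y p)) = 0"
      using sol X(1) Y(1) by (simp add: eta_Ricci_soliton_def)
    moreover have "ricci A nabla X Y p = a * g p (X p) (Y p) + c * (\<eta> p (X p) * \<eta> p (Y p))"
      using ein X(1) Y(1) by (simp add: eta_Einstein_def)
    moreover have "lie_derivative_metric \<xi> g X Y p = 2 * f p * (g p x y - \<epsilon> * \<eta> p x * \<eta> p y)"
      using x y by (simp add: lie_derivative_metric_xi X Y torse_forming_nabla[OF tf] g_left_linear
          g_right_linear tangent_closed xi_at g_xi g_sym[OF xi_at] algebra_simps)
    ultimately show ?thesis using X(2) Y(2) by (simp add: algebra_simps)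
  qed
  have "(f q + a + lam) * \<epsilon> + (c + \<mu> - \<epsilon> * f q) = 0" for q
    using eq[OF xi_at xi_at, of q] by (simp add: g_xi xi_at eta_xi)
  then have coeff: "c + \<mu> - \<epsilon> * f q = - (f q + a + lam) * \<epsilon>" for q
    by (simp add: algebra_simps)
  have "(a + lam) * \<epsilon> + (c + \<mu>) = 0"
    using coeff[of undefined] by (simp add: algebra_simps)
  moreover have "a + lam + \<epsilon> * (c + \<mu>) = \<epsilon> * ((a + lam) * \<epsilon> + (c + \<mu>))"
    by (simp add: algebra_simps eps_square)
  ultimately show "a + lam + \<epsilon> * (c + \<mu>) = 0" by simp
  assume x: "x \<in> tangent_space A p"
  show "(f p + a + lam) *\<^sub>R (x - \<eta> p x *\<^sub>R \<xi> p) = 0"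
  proof (rule g_nondegenerate)
    fix y assume y: "y \<in> tangent_space A p"
    have "g p ((f p + a + lam) *\<^sub>R (x - \<eta> p x *\<^sub>R \<xi> p)) y
        = (f p + a + lam) * g p x y - (f p + a + lam) * \<epsilon> * (\<eta> p x * \<eta> p y)"
      using x y by (simp add: g_left_linear tangent_closed xi_at g_sym[OF xi_at y] g_xi right_diff_distrib)
    also have "\<dots> = 0"
      using eq[OF x y] unfolding coeff by (simp add: algebra_simps)
    finally show "g p ((f p + a + lam) *\<^sub>R (x - \<eta> p x *\<^sub>R \<xi> p)) y = 0" .
  qed (intro tangent_closed x xi_at)
qed

text \<open>
  Both second derivatives contain, besides \<open>k \<nabla>\<^sub>X Y\<close> and \<open>-k \<eta>(\<nabla>\<^sub>X Y) \<xi>\<close>, whose antisymmetric parts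
  are removed by the bracket term, only a multiple of \<open>\<xi>\<close> that is symmetric in \<open>X\<close> and \<open>Y\<close>, and
  the term \<open>-k\<^sup>2 \<eta>(Y) (X - \<eta>(X) \<xi>)\<close>, which remains.
\<close>

lemma curvature_xi:
  assumes nab: "\<And>X p. vector_field A X \<Longrightarrow> nabla X \<xi> p = k *\<^sub>R (X p - \<eta> p (X p) *\<^sub>R \<xi> p)"
    and X: "vector_field A X" and Y: "vector_field A Y"
  shows "curvature nabla X Y \<xi> p = k\<^sup>2 *\<^sub>R (\<eta> p (X p) *\<^sub>R Y p - \<eta> p (Y p) *\<^sub>R X p)"
proof -
  let ?h = "\<lambda>X Y. g p (X p) (Y p) - \<epsilon> * \<eta> p (X p) * \<eta> p (Y p)"
  \<comment> \<open>the contribution of \<open>?h\<close>, being symmetric, cancels in the curvature\<close>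
  have second: "nabla X (nabla Y \<xi>) p = k *\<^sub>R nabla X Y p
      - (k * (\<eta> p (nabla X Y p) + \<epsilon> * (k * ?h X Y))) *\<^sub>R \<xi> p
      - (k\<^sup>2 * \<eta> p (Y p)) *\<^sub>R (X p - \<eta> p (X p) *\<^sub>R \<xi> p)"
    if X: "vector_field A X" and Y: "vector_field A Y" for X Y
  proof -
    have nabY: "nabla Y \<xi> = fscale (\<lambda>_. k) Y + fscale (\<lambda>q. - k * \<eta> q (Y q)) \<xi>"
      by (rule ext) (simp add: nab[OF Y] fscale_def scaleR_right_diff_distrib)
    have sm: "smooth_fun A (\<lambda>q. - k * \<eta> q (Y q))"
      by (intro smooth_fun_mult[OF manifold] smooth_fun_const[OF manifold] smooth_fun_eta Y)
    have "g p (Y p) (nabla X \<xi> p) = k * ?h X Y"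
      using vector_field_at[OF X, of p] vector_field_at[OF Y, of p]
      by (simp add: nab[OF X] g_right_linear tangent_closed xi_at g_xi g_sym[of "X p" p "Y p"])
    then have d: "X p (\<lambda>q. - k * \<eta> q (Y q)) = - k * (\<eta> p (nabla X Y p) + \<epsilon> * (k * ?h X Y))"
      using tangent_space_scale[OF vector_field_at[OF X] smooth_fun_eta[OF Y], where r = "- k"]
      by (simp only: deriv_eta[OF X Y])
    have "nabla X (nabla Y \<xi>) p = k *\<^sub>R nabla X Y p
        + (X p (\<lambda>q. - k * \<eta> q (Y q)) *\<^sub>R \<xi> p + (- k * \<eta> p (Y p)) *\<^sub>R nabla X \<xi> p)"
      unfolding nabY
      by (simp only: nabla_add[OF X vector_field_fscale[OF smooth_fun_const[OF manifold] Y]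
            vector_field_fscale[OF sm xi]] nabla_fscale[OF smooth_fun_const[OF manifold] X Y]
          nabla_fscale[OF sm X xi] tangent_space_const[OF manifold vector_field_at[OF X]]
          scaleR_zero_left add_0_left)
    then show ?thesis
      unfolding d nab[OF X] by (simp add: power2_eq_square algebra_simps)
  qed
  have third: "nabla (lie_bracket X Y) \<xi> p = k *\<^sub>R (nabla X Y p - nabla Y X p
      - (\<eta> p (nabla X Y p) - \<eta> p (nabla Y X p)) *\<^sub>R \<xi> p)"
    using vector_field_at[OF vector_field_nabla[OF X Y]] vector_field_at[OF vector_field_nabla[OF Y X]]
    by (simp add: nab vector_field_lie_bracket X Y lie_bracket_at eta_linear)
  have sym: "g p (Y p) (X p) = g p (X p) (Y p)"
    by (intro g_sym vector_field_at X Y)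
  show ?thesis
    by (simp add: curvature_def second X Y third sym algebra_simps)
qed

lemma ricci_xi:
  assumes nab: "\<And>X p. vector_field A X \<Longrightarrow> nabla X \<xi> p = k *\<^sub>R (X p - \<eta> p (X p) *\<^sub>R \<xi> p)"
    and Y: "vector_field A Y"
  shows "ricci A nabla Y \<xi> p = k\<^sup>2 * (1 - real DIM('e)) * \<eta> p (Y p)"
proof -
  have "ricci A nabla Y \<xi> p = k\<^sup>2 * \<eta> p (Y p) - (k\<^sup>2 * \<eta> p (Y p)) * real DIM('e)"
    unfolding ricci_def
  proof (rule trace_on_rank_one_minus_scalar[where \<alpha> = "\<lambda>x. k\<^sup>2 * \<eta> p x"])
    show "linear_map_on (tangent_space A p) (\<lambda>x. k\<^sup>2 * \<eta> p x)"
      by (auto simp: linear_map_on_def eta_linear algebra_simps)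
    fix x assume "x \<in> tangent_space A p"
    then have "vector_field A (extension A p x)" "extension A p x p = x"
      using someI_ex[OF vector_field_through_exists[OF manifold]] by (auto simp: extension_def)
    then show "curvature nabla (extension A p x) Y \<xi> p
        = (k\<^sup>2 * \<eta> p x) *\<^sub>R Y p - (k\<^sup>2 * \<eta> p (Y p)) *\<^sub>R x"
      using curvature_xi[OF nab _ Y] by (simp add: scaleR_right_diff_distrib)
  qed (use tangent_space_basis[OF manifold] vector_field_at[OF Y] in blast)+
  then show ?thesis by (simp add: algebra_simps)
qed

lemma horizontal_vector_exists:
  assumes "DIM('e) \<ge> 2"
  obtains x where "x \<in> tangent_space A p" "x - \<eta> p x *\<^sub>R \<xi> p \<noteq> 0"
proof -
  obtain B where B: "independent B" "span B = tangent_space A p"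
    using tangent_space_basis(1)[OF manifold] by blast
  have "\<not> B \<subseteq> span {\<xi> p}"
    using independent_span_bound[of "{\<xi> p}" B] B tangent_space_basis(2)[OF manifold B] assms by auto
  then obtain x where "x \<in> B" "x \<notin> span {\<xi> p}" by blast
  moreover from this have "x \<noteq> \<eta> p x *\<^sub>R \<xi> p"
    by (metis insertI1 span_base span_scale)
  ultimately show thesis
    using that[of x] B(2) span_base by auto
qed

end

theorem theorem3p5:
  fixes A :: "('m::{t2_space, second_countable_topology}, 'e::euclidean_space) chart set"
    and \<phi> :: "'m \<Rightarrow> 'm tvec \<Rightarrow> 'm tvec"
    and \<xi> :: "'m vfield"
    and \<eta> w :: "'m \<Rightarrow> 'm tvec \<Rightarrow> real"
    and g :: "'m \<Rightarrow> 'm tvec \<Rightarrow> 'm tvec \<Rightarrow> real"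
    and nabla :: "'m vfield \<Rightarrow> 'm vfield \<Rightarrow> 'm vfield"
    and f :: "'m \<Rightarrow> real"
    and \<epsilon> a c lam \<mu> :: real
    and n :: nat
  assumes "smooth_manifold A" and "n = DIM('e)"
    and "almost_paracontact_metric A \<phi> \<xi> \<eta> g \<epsilon>"
    and "levi_civita A g nabla"
    and "eta_Einstein A \<eta> g nabla a c"
    and "eta_Ricci_soliton A \<eta> g nabla \<xi> lam \<mu>"
    and "torse_forming A nabla \<xi> f w"
  shows "(n \<ge> 2 \<longrightarrow> f constant_on UNIV) \<and>
         c = - \<epsilon> * a + (a + lam)\<^sup>2 * (1 - real n) \<and>
         \<mu> = - \<epsilon> * (lam + \<epsilon> * (a + lam)\<^sup>2 * (1 - real n))"
proof -
  interpret paracontact_levi_civita A \<phi> \<xi> \<eta> g \<epsilon> nabla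
    by unfold_locales (fact assms)+
  note soliton = torse_forming_soliton[OF assms(7,5,6)]
  have const: "f constant_on UNIV" if "n \<ge> 2"
  proof -
    have "f p = - (a + lam)" for p
    proof -
      obtain x where "x \<in> tangent_space A p" "x - \<eta> p x *\<^sub>R \<xi> p \<noteq> 0"
        using horizontal_vector_exists \<open>n \<ge> 2\<close> \<open>n = DIM('e)\<close> by blast
      with soliton(2)[of x p] show ?thesis by simp
    qed
    then show ?thesis unfolding constant_on_def by blast
  qed
  \<comment> \<open>in dimension one both sides vanish, whatever \<open>f\<close> is\<close>
  have nab: "nabla X \<xi> p = (- (a + lam)) *\<^sub>R (X p - \<eta> p (X p) *\<^sub>R \<xi> p)" if X: "vector_field A X" for X p
  proof -
    have "nabla X \<xi> p = (f p + a + lam) *\<^sub>R (X p - \<eta> p (X p) *\<^sub>R \<xi> p)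
        + (- (a + lam)) *\<^sub>R (X p - \<eta> p (X p) *\<^sub>R \<xi> p)"
      unfolding torse_forming_nabla[OF assms(7) X] scaleR_left_distrib[symmetric] by simp
    then show ?thesis using soliton(2)[OF vector_field_at[OF X]] by simp
  qed
  have "ricci A nabla \<xi> \<xi> undefined = a * \<epsilon> + c"
    using assms(5) xi by (simp add: eta_Einstein_def g_xi xi_at eta_xi)
  moreover have "ricci A nabla \<xi> \<xi> undefined = (a + lam)\<^sup>2 * (1 - real n)"
    using ricci_xi[OF nab xi] \<open>n = DIM('e)\<close> by (simp only: eta_xi power2_minus mult_1_right)
  ultimately have c: "c = - \<epsilon> * a + (a + lam)\<^sup>2 * (1 - real n)"
    by simp
  have "\<epsilon> * (a + lam + \<epsilon> * (c + \<mu>)) = 0" using soliton(1) by simp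
  then have "\<mu> = - \<epsilon> * (a + lam) - c" by (simp add: distrib_left eps_square)
  also have "\<dots> = - \<epsilon> * (lam + \<epsilon> * (a + lam)\<^sup>2 * (1 - real n))"
    using eps_square(2)[of "(a + lam)\<^sup>2 * (1 - real n)"] unfolding c by (simp add: algebra_simps)
  finally show ?thesis using const c by blast
qed

end
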